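(* Let $G$ be a topological group and let $d\in\Delta(G)$ be generating the topology of $G$. If $\ell(G,d)=0$, then $\ell(G)=0$, and thus $G$ is extremely amenable.
   Context: For a topological group $G$, $\mathrm{RUCB}(G)$ is the algebra of all bounded functions $f\colon G\to\mathbb{R}$ such that for every $\epsilon>0$ there is a neighborhood $U$ of $e$ with $\sup_{x\in G}|f(x)-f(gx)|\le\epsilon$ for all $g\in U$. $G$ is amenable if there is a positive unital linear functional $\mu$ on $\mathrm{RUCB}(G)$ with $\mu(f\circ\lambda_g)=\mu(f)$ for all $f\in\mathrm{RUCB}(G)$, $g\in G$, where $\lambda_g(x)=gx$. $G$ is extremely amenable if every (jointly) continuous action of $G$ on a non-empty compact Hausdorff space has a fixed point. Subgroups carry the relative topology. Amenable length. $\Delta(G)$ is the set of all bounded, continuous, right-invariant pseudo-metrics on $G$ (continuous: the generated topology is contained in that of $G$; right-invariant: $d(xg,yg)=d(x,y)$). $\mathscr{A}(G)$ is the set of all amenable topological subgroups of $G$, and $\mathscr{A}^*(G)$ is the set of all finite tuples $(G_0,\dots,G_n)$, $n\in\mathbb{N}$, of members of $\mathscr{A}(G)$ with $\{e\}=G_0\le\dots\le G_n=G$. For $d\in\Delta(G)$ and $(G_0,\dots,G_n)\in\mathscr{A}^*(G)$ let $$\ell(G_0,\dots,G_n;d):=\Bigl(\sum_{i=0}^{n-1}\bigl(\sup_{g\in G}\operatorname{diam}(G_{i+1}/G_i,d_i^g)\bigr)^2\Bigr)^{1/2},\qquad d_i^g(xG_i,yG_i):=\inf_{h\in G_i}d(gx,gyh),$$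 and let $\ell(G,d):=\inf\{\ell(G_0,\dots,G_n;d)\mid(G_0,\dots,G_n)\in\mathscr{A}^*(G)\}\in[0,\infty]$ (with $\inf\emptyset=\infty$). For a neighborhood $U$ of $e$ in $G$ and a finite subset $F\subseteq G$, let $\mathrm{T}_G(U,F)$ be the set of all pairs $(H,d)$ with $H\in\mathscr{A}(G)$, $d\in\Delta(H)$, $F\subseteq UH$ and $\{x\in H\mid d(e,x)<1\}\subseteq U$. Then $$\ell(G):=\sup\Bigl\{\inf_{(H,d)\in\mathrm{T}_G(U,F)}\ell(H,d)\ \Big|\ U\text{ neighborhood of }e,\ F\subseteq G\text{ finite}\Bigr\}\in[0,\infty].$$ *)

theory Defs
  imports "HOL-Analysis.Analysis" "HOL-Algebra.Left_Coset" "HOL-Algebra.Group_Action"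
begin

section \<open>Topological groups and amenability\<close>

text \<open>
  Subgroups are subsets \<open>H\<close> of \<open>carrier G\<close>; as topological groups they are represented by
  \<open>G\<lparr>carrier := H\<rparr>\<close> together with \<open>subtopology T H\<close>.  No separation axiom is imposed.
\<close>

locale topological_group = group G for G (structure) +
  fixes T :: "'a topology"
  assumes topspace_eq: "topspace T = carrier G"
    and continuous_mult: "continuous_map (prod_topology T T) T (\<lambda>(x, y). x \<otimes> y)"
    and continuous_inv: "continuous_map T T (\<lambda>x. inv x)"

definition nbhd_of :: "'a topology \<Rightarrow> 'a \<Rightarrow> 'a set \<Rightarrow> bool" where
  "nbhd_of T x U \<longleftrightarrow> U \<subseteq> topspace T \<and> (\<exists>V. openin T V \<and> x \<in> V \<and> V \<subseteq> U)"

text \<open>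
  Functions on \<open>carrier G\<close> are made unique by requiring them to be extensional, so that
  a functional on \<open>RUCB G T\<close> depends only on the values on \<open>carrier G\<close>.
\<close>

definition RUCB :: "('a, 'b) monoid_scheme \<Rightarrow> 'a topology \<Rightarrow> ('a \<Rightarrow> real) set" where
  "RUCB G T = {f \<in> extensional (carrier G).
     (\<exists>B. \<forall>x\<in>carrier G. \<bar>f x\<bar> \<le> B) \<and>
     (\<forall>\<epsilon>>0. \<exists>U. nbhd_of T \<one>\<^bsub>G\<^esub> U \<and>
        (\<forall>g\<in>U. (SUP x\<in>carrier G. \<bar>f x - f (g \<otimes>\<^bsub>G\<^esub> x)\<bar>) \<le> \<epsilon>))}"

definition amenable :: "('a, 'b) monoid_scheme \<Rightarrow> 'a topology \<Rightarrow> bool" where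
  "amenable G T \<longleftrightarrow> (\<exists>\<mu> :: ('a \<Rightarrow> real) \<Rightarrow> real.
     (\<forall>f\<in>RUCB G T. \<forall>h\<in>RUCB G T. \<forall>a b.
        \<mu> (\<lambda>x\<in>carrier G. a * f x + b * h x) = a * \<mu> f + b * \<mu> h) \<and>
     (\<forall>f\<in>RUCB G T. (\<forall>x\<in>carrier G. 0 \<le> f x) \<longrightarrow> 0 \<le> \<mu> f) \<and>
     \<mu> (\<lambda>x\<in>carrier G. 1) = 1 \<and>
     (\<forall>f\<in>RUCB G T. \<forall>g\<in>carrier G. \<mu> (\<lambda>x\<in>carrier G. f (g \<otimes>\<^bsub>G\<^esub> x)) = \<mu> f))"

text \<open>
  The type argument is the type from which the points of the compact spaces are drawn; extreme
  amenability is \<open>extremely_amenable TYPE('x) G T\<close> for all types \<open>'x\<close>, i.e. a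
  conclusion in which \<open>'x\<close> is a free type variable.
\<close>

definition extremely_amenable ::
    "'x itself \<Rightarrow> ('a, 'b) monoid_scheme \<Rightarrow> 'a topology \<Rightarrow> bool" where
  "extremely_amenable _ G T \<longleftrightarrow> (\<forall>(X :: 'x topology) \<phi>.
     topspace X \<noteq> {} \<and> compact_space X \<and> Hausdorff_space X \<and>
     group_action G (topspace X) \<phi> \<and>
     continuous_map (prod_topology T X) X (\<lambda>(g, x). \<phi> g x) \<longrightarrow>
     (\<exists>x\<in>topspace X. \<forall>g\<in>carrier G. \<phi> g x = x))"

section \<open>Continuous right-invariant pseudo-metrics\<close>

definition pseudometric_on :: "'a set \<Rightarrow> ('a \<Rightarrow> 'a \<Rightarrow> real) \<Rightarrow> bool" where
  "pseudometric_on M d \<longleftrightarrow>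
     (\<forall>x\<in>M. d x x = 0) \<and>
     (\<forall>x\<in>M. \<forall>y\<in>M. 0 \<le> d x y \<and> d x y = d y x) \<and>
     (\<forall>x\<in>M. \<forall>y\<in>M. \<forall>z\<in>M. d x z \<le> d x y + d y z)"

definition pseudometric_topology :: "'a set \<Rightarrow> ('a \<Rightarrow> 'a \<Rightarrow> real) \<Rightarrow> 'a topology" where
  "pseudometric_topology M d =
     topology (\<lambda>U. U \<subseteq> M \<and> (\<forall>x\<in>U. \<exists>r>0. {y \<in> M. d x y < r} \<subseteq> U))"

lemma openin_pseudometric_topology:
  "openin (pseudometric_topology M d) U \<longleftrightarrow>
     U \<subseteq> M \<and> (\<forall>x\<in>U. \<exists>r>0. {y \<in> M. d x y < r} \<subseteq> U)"
proof -
  have "istopology (\<lambda>U. U \<subseteq> M \<and> (\<forall>x\<in>U. \<exists>r>0. {y \<in> M. d x y < r} \<subseteq> U))"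
    unfolding istopology_def
  proof (intro conjI allI impI)
    fix S S' assume S: "S \<subseteq> M \<and> (\<forall>x\<in>S. \<exists>r>0. {y \<in> M. d x y < r} \<subseteq> S)"
      and S': "S' \<subseteq> M \<and> (\<forall>x\<in>S'. \<exists>r>0. {y \<in> M. d x y < r} \<subseteq> S')"
    show "S \<inter> S' \<subseteq> M" using S by blast
    show "\<forall>x\<in>S \<inter> S'. \<exists>r>0. {y \<in> M. d x y < r} \<subseteq> S \<inter> S'"
    proof
      fix x assume "x \<in> S \<inter> S'"
      then obtain r r' where "r > 0" "{y \<in> M. d x y < r} \<subseteq> S"
        "r' > 0" "{y \<in> M. d x y < r'} \<subseteq> S'"
        using S S' by (meson IntE)
      then show "\<exists>r>0. {y \<in> M. d x y < r} \<subseteq> S \<inter> S'"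
        by (intro exI[of _ "min r r'"]) auto
    qed
  next
    fix K assume K: "\<forall>U\<in>K. U \<subseteq> M \<and> (\<forall>x\<in>U. \<exists>r>0. {y \<in> M. d x y < r} \<subseteq> U)"
    show "\<Union> K \<subseteq> M" using K by blast
    show "\<forall>x\<in>\<Union> K. \<exists>r>0. {y \<in> M. d x y < r} \<subseteq> \<Union> K"
      using K by (meson UnionE Union_upper subset_trans)
  qed
  then show ?thesis
    by (simp add: pseudometric_topology_def)
qed

definition Delta :: "('a, 'b) monoid_scheme \<Rightarrow> 'a topology \<Rightarrow> ('a \<Rightarrow> 'a \<Rightarrow> real) set" where
  "Delta G T = {d. pseudometric_on (carrier G) d \<and>
     (\<exists>B. \<forall>x\<in>carrier G. \<forall>y\<in>carrier G. d x y \<le> B) \<and>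
     (\<forall>U. openin (pseudometric_topology (carrier G) d) U \<longrightarrow> openin T U) \<and>
     (\<forall>x\<in>carrier G. \<forall>y\<in>carrier G. \<forall>g\<in>carrier G.
        d (x \<otimes>\<^bsub>G\<^esub> g) (y \<otimes>\<^bsub>G\<^esub> g) = d x y)}"

section \<open>Amenable length\<close>

definition amenable_subgroups :: "('a, 'b) monoid_scheme \<Rightarrow> 'a topology \<Rightarrow> 'a set set" where
  "amenable_subgroups G T =
     {H. subgroup H G \<and> amenable (G\<lparr>carrier := H\<rparr>) (subtopology T H)}"

definition amenable_chains :: "('a, 'b) monoid_scheme \<Rightarrow> 'a topology \<Rightarrow> 'a set list set" where
  "amenable_chains G T = {Gs. Gs \<noteq> [] \<and> set Gs \<subseteq> amenable_subgroups G T \<and>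
     hd Gs = {\<one>\<^bsub>G\<^esub>} \<and> last Gs = carrier G \<and>
     (\<forall>i. Suc i < length Gs \<longrightarrow> Gs ! i \<subseteq> Gs ! Suc i)}"

text \<open>
  The pseudo-metric on left cosets is specified by its value on representatives; the lemma below
  shows that this value does not depend on the representatives.
\<close>

definition coset_dist ::
    "('a, 'b) monoid_scheme \<Rightarrow> ('a \<Rightarrow> 'a \<Rightarrow> real) \<Rightarrow> 'a set \<Rightarrow> 'a \<Rightarrow> 'a set \<Rightarrow> 'a set \<Rightarrow> real" where
  "coset_dist G d K g A B = (THE r. \<exists>x\<in>carrier G. \<exists>y\<in>carrier G.
     A = x <#\<^bsub>G\<^esub> K \<and> B = y <#\<^bsub>G\<^esub> K \<and>
     r = (INF h\<in>K. d (g \<otimes>\<^bsub>G\<^esub> x) (g \<otimes>\<^bsub>G\<^esub> (y \<otimes>\<^bsub>G\<^esub> h))))"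

lemma coset_dist_eq:
  assumes "group G" and K: "subgroup K G" and d: "d \<in> Delta G T"
    and g: "g \<in> carrier G" and x: "x \<in> carrier G" and y: "y \<in> carrier G"
  shows "coset_dist G d K g (x <#\<^bsub>G\<^esub> K) (y <#\<^bsub>G\<^esub> K) =
    (INF h\<in>K. d (g \<otimes>\<^bsub>G\<^esub> x) (g \<otimes>\<^bsub>G\<^esub> (y \<otimes>\<^bsub>G\<^esub> h)))"
proof -
  interpret group G by fact
  note [simp] = subgroup.mem_carrier[OF K]
  have *: "(\<lambda>h. d (g \<otimes>\<^bsub>G\<^esub> a) (g \<otimes>\<^bsub>G\<^esub> (b \<otimes>\<^bsub>G\<^esub> h))) ` K
      \<subseteq> (\<lambda>h. d (g \<otimes>\<^bsub>G\<^esub> x') (g \<otimes>\<^bsub>G\<^esub> (y' \<otimes>\<^bsub>G\<^esub> h))) ` K"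
    if a: "a \<in> carrier G" and b: "b \<in> carrier G"
      and x': "x' \<in> carrier G" and y': "y' \<in> carrier G"
      and ax: "a <#\<^bsub>G\<^esub> K = x' <#\<^bsub>G\<^esub> K" and yb: "b <#\<^bsub>G\<^esub> K = y' <#\<^bsub>G\<^esub> K"
    for a b x' y'
  proof
    fix r assume "r \<in> (\<lambda>h. d (g \<otimes>\<^bsub>G\<^esub> a) (g \<otimes>\<^bsub>G\<^esub> (b \<otimes>\<^bsub>G\<^esub> h))) ` K"
    then obtain h where h: "h \<in> K" "r = d (g \<otimes>\<^bsub>G\<^esub> a) (g \<otimes>\<^bsub>G\<^esub> (b \<otimes>\<^bsub>G\<^esub> h))"
      by blast
    have "a \<in> x' <#\<^bsub>G\<^esub> K"
      using ax a subgroup.one_closed[OF K] by (force simp: l_coset_def)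
    then obtain k where k: "k \<in> K" "a = x' \<otimes>\<^bsub>G\<^esub> k" by (auto simp: l_coset_def)
    have "b \<in> y' <#\<^bsub>G\<^esub> K"
      using yb b subgroup.one_closed[OF K] by (force simp: l_coset_def)
    then obtain l where l: "l \<in> K" "b = y' \<otimes>\<^bsub>G\<^esub> l" by (auto simp: l_coset_def)
    let ?h = "l \<otimes>\<^bsub>G\<^esub> h \<otimes>\<^bsub>G\<^esub> inv\<^bsub>G\<^esub> k"
    have hK: "?h \<in> K"
      using h k l K by (simp add: subgroup.m_closed subgroup.m_inv_closed)
    have inv: "d (u \<otimes>\<^bsub>G\<^esub> k) (v \<otimes>\<^bsub>G\<^esub> k) = d u v"
      if "u \<in> carrier G" "v \<in> carrier G" for u v
      using d that k by (simp add: Delta_def)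
    have "d (g \<otimes>\<^bsub>G\<^esub> x') (g \<otimes>\<^bsub>G\<^esub> (y' \<otimes>\<^bsub>G\<^esub> ?h))
        = d (g \<otimes>\<^bsub>G\<^esub> x' \<otimes>\<^bsub>G\<^esub> k) (g \<otimes>\<^bsub>G\<^esub> (y' \<otimes>\<^bsub>G\<^esub> ?h) \<otimes>\<^bsub>G\<^esub> k)"
      using g x' y' h k l by (subst inv) auto
    also have "\<dots> = r"
      using g x' y' h k l by (simp add: m_assoc)
    finally show "r \<in> (\<lambda>h. d (g \<otimes>\<^bsub>G\<^esub> x') (g \<otimes>\<^bsub>G\<^esub> (y' \<otimes>\<^bsub>G\<^esub> h))) ` K"
      using hK by (metis image_eqI)
  qed
  show ?thesis
    unfolding coset_dist_def
  proof (rule the_equality)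
    fix r assume "\<exists>a\<in>carrier G. \<exists>b\<in>carrier G.
        x <#\<^bsub>G\<^esub> K = a <#\<^bsub>G\<^esub> K \<and> y <#\<^bsub>G\<^esub> K = b <#\<^bsub>G\<^esub> K \<and>
        r = (INF h\<in>K. d (g \<otimes>\<^bsub>G\<^esub> a) (g \<otimes>\<^bsub>G\<^esub> (b \<otimes>\<^bsub>G\<^esub> h)))"
    then obtain a b where ab: "a \<in> carrier G" "b \<in> carrier G"
      "x <#\<^bsub>G\<^esub> K = a <#\<^bsub>G\<^esub> K" "y <#\<^bsub>G\<^esub> K = b <#\<^bsub>G\<^esub> K"
      and r: "r = (INF h\<in>K. d (g \<otimes>\<^bsub>G\<^esub> a) (g \<otimes>\<^bsub>G\<^esub> (b \<otimes>\<^bsub>G\<^esub> h)))"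
      by blast
    show "r = (INF h\<in>K. d (g \<otimes>\<^bsub>G\<^esub> x) (g \<otimes>\<^bsub>G\<^esub> (y \<otimes>\<^bsub>G\<^esub> h)))"
      unfolding r
      by (rule arg_cong[where f = Inf], rule subset_antisym;
          rule *[OF _ _ _ _ _ _]) (use ab x y in simp_all)
  qed (use x y in blast)
qed

text \<open>
  Diameter of \<open>L / K\<close>.  The real suprema here and in \<open>chain_length\<close> are over nonempty sets
  that are bounded because members of \<open>Delta G T\<close> are bounded.
\<close>

definition coset_diam ::
    "('a, 'b) monoid_scheme \<Rightarrow> ('a \<Rightarrow> 'a \<Rightarrow> real) \<Rightarrow> 'a set \<Rightarrow> 'a set \<Rightarrow> 'a \<Rightarrow> real" where
  "coset_diam G d L K g =
     (SUP (A, B) \<in> (lcosets\<^bsub>G\<lparr>carrier := L\<rparr>\<^esub> K) \<times> (lcosets\<^bsub>G\<lparr>carrier := L\<rparr>\<^esub> K).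
        coset_dist G d K g A B)"

definition chain_length ::
    "('a, 'b) monoid_scheme \<Rightarrow> 'a set list \<Rightarrow> ('a \<Rightarrow> 'a \<Rightarrow> real) \<Rightarrow> real" where
  "chain_length G Gs d = sqrt (\<Sum>i<length Gs - 1.
     (SUP g\<in>carrier G. coset_diam G d (Gs ! Suc i) (Gs ! i) g)\<^sup>2)"

definition metric_amenable_length ::
    "('a, 'b) monoid_scheme \<Rightarrow> 'a topology \<Rightarrow> ('a \<Rightarrow> 'a \<Rightarrow> real) \<Rightarrow> ennreal" where
  "metric_amenable_length G T d = (INF Gs\<in>amenable_chains G T. ennreal (chain_length G Gs d))"

definition TG ::
    "('a, 'b) monoid_scheme \<Rightarrow> 'a topology \<Rightarrow> 'a set \<Rightarrow> 'a set \<Rightarrow> ('a set \<times> ('a \<Rightarrow> 'a \<Rightarrow> real)) set" where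
  "TG G T U F = {(H, d). H \<in> amenable_subgroups G T \<and>
     d \<in> Delta (G\<lparr>carrier := H\<rparr>) (subtopology T H) \<and>
     F \<subseteq> U <#>\<^bsub>G\<^esub> H \<and> {x \<in> H. d \<one>\<^bsub>G\<^esub> x < 1} \<subseteq> U}"

definition amenable_length :: "('a, 'b) monoid_scheme \<Rightarrow> 'a topology \<Rightarrow> ennreal" where
  "amenable_length G T =
     (SUP (U, F) \<in> {(U, F). nbhd_of T \<one>\<^bsub>G\<^esub> U \<and> finite F \<and> F \<subseteq> carrier G}.
        INF (H, d) \<in> TG G T U F.
          metric_amenable_length (G\<lparr>carrier := H\<rparr>) (subtopology T H) d)"

end

theory Submission
  imports Defs
begin

text \<open>
  An invariant mean on \<open>H\<close> averages a right uniformly continuous bounded function over the left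
  cosets of \<open>H\<close>; this averaging commutes with left translations and preserves \<open>d\<close>-Lipschitz
  constants.  Composing the averages along a chain \<open>{e} = G\<^sub>0 \<le> \<dots> \<le> G\<^sub>n = G\<close> gives a left-invariant mean
  on \<open>G\<close>.  The function obtained after \<open>i\<close> steps is right \<open>G\<^sub>i\<close>-invariant, so on a coset of
  \<open>G\<^sub>i\<^sub>+\<^sub>1\<close> it oscillates at most by the Lipschitz constant times the \<open>i\<close>-th diameter; hence, as for
  martingale differences, the variance of a \<open>1\<close>-Lipschitz function is at most the square of the
  length of the chain.  If chains of arbitrarily small length exist, finitely many Lipschitz
  functions are simultaneously almost invariant under finitely many translations at some point
  of \<open>G\<close>.  Applied to functions on an orbit in a compact space, this yields a fixed point.
  That the length of \<open>G\<close> vanishes follows by taking \<open>H = G\<close> and multiples of \<open>d\<close>.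
\<close>

section \<open>Right uniformly continuous bounded functions\<close>

text \<open>The non-extensional variant of \<^const>\<open>RUCB\<close>.\<close>

definition rucb :: "('a, 'b) monoid_scheme \<Rightarrow> 'a topology \<Rightarrow> ('a \<Rightarrow> real) \<Rightarrow> bool" where
  "rucb G T f \<longleftrightarrow> (\<exists>B. \<forall>x\<in>carrier G. \<bar>f x\<bar> \<le> B) \<and>
     (\<forall>\<epsilon>>0. \<exists>U. openin T U \<and> \<one>\<^bsub>G\<^esub> \<in> U \<and>
        (\<forall>g\<in>U. \<forall>x\<in>carrier G. \<bar>f (g \<otimes>\<^bsub>G\<^esub> x) - f x\<bar> \<le> \<epsilon>))"

lemma rucbI:
  assumes "\<And>x. x \<in> carrier G \<Longrightarrow> \<bar>f x\<bar> \<le> B"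
    and "\<And>\<epsilon>. \<epsilon> > 0 \<Longrightarrow> \<exists>U. openin T U \<and> \<one>\<^bsub>G\<^esub> \<in> U \<and>
        (\<forall>g\<in>U. \<forall>x\<in>carrier G. \<bar>f (g \<otimes>\<^bsub>G\<^esub> x) - f x\<bar> \<le> \<epsilon>)"
  shows "rucb G T f"
  using assms unfolding rucb_def by blast

lemma rucb_bound:
  assumes "rucb G T f"
  obtains B where "B > 0" "\<And>x. x \<in> carrier G \<Longrightarrow> \<bar>f x\<bar> \<le> B"
proof -
  from assms obtain B where "\<forall>x\<in>carrier G. \<bar>f x\<bar> \<le> B"
    unfolding rucb_def by blast
  then show ?thesis
    by (intro that[of "max B 1"]) (auto simp: max_def intro: order_trans)
qed

lemma rucb_unif:
  assumes "rucb G T f" "\<epsilon> > 0"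
  obtains U where "openin T U" "\<one>\<^bsub>G\<^esub> \<in> U"
    "\<And>g x. g \<in> U \<Longrightarrow> x \<in> carrier G \<Longrightarrow> \<bar>f (g \<otimes>\<^bsub>G\<^esub> x) - f x\<bar> \<le> \<epsilon>"
proof -
  have "\<exists>U. openin T U \<and> \<one>\<^bsub>G\<^esub> \<in> U \<and>
      (\<forall>g\<in>U. \<forall>x\<in>carrier G. \<bar>f (g \<otimes>\<^bsub>G\<^esub> x) - f x\<bar> \<le> \<epsilon>)"
    using assms by (simp add: rucb_def)
  then show ?thesis using that by (elim exE conjE) simp
qed

lemma rucb_lincomb:
  assumes f: "rucb G T f" and h: "rucb G T h"
  shows "rucb G T (\<lambda>x. a * f x + b * h x)"
proof -
  obtain B where B: "\<And>x. x \<in> carrier G \<Longrightarrow> \<bar>f x\<bar> \<le> B" using rucb_bound[OF f] by metis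
  obtain C where C: "\<And>x. x \<in> carrier G \<Longrightarrow> \<bar>h x\<bar> \<le> C" using rucb_bound[OF h] by metis
  have lin: "\<bar>a * u + b * v\<bar> \<le> \<bar>a\<bar> * r + \<bar>b\<bar> * s" if "\<bar>u\<bar> \<le> r" "\<bar>v\<bar> \<le> s" for u v r s
    using that by (intro order_trans[OF abs_triangle_ineq] add_mono) (auto simp: abs_mult mult_left_mono)
  show ?thesis
  proof (rule rucbI)
    show "\<bar>a * f x + b * h x\<bar> \<le> \<bar>a\<bar> * B + \<bar>b\<bar> * C" if "x \<in> carrier G" for x
      using lin B C that by blast
  next
    fix \<epsilon> :: real assume "\<epsilon> > 0"
    \<comment> \<open>The \<open>+ 1\<close> keeps the denominator positive when \<open>a\<close>
      and \<open>b\<close> both vanish.\<close>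
    define \<delta> where "\<delta> = \<epsilon> / (\<bar>a\<bar> + \<bar>b\<bar> + 1)"
    have "\<delta> > 0" using \<open>\<epsilon> > 0\<close> by (simp add: \<delta>_def add_nonneg_pos)
    have \<delta>: "\<bar>a\<bar> * \<delta> + \<bar>b\<bar> * \<delta> \<le> \<epsilon>"
    proof -
      have "(\<bar>a\<bar> + \<bar>b\<bar> + 1) * \<delta> = \<epsilon>" by (simp add: \<delta>_def add_nonneg_eq_0_iff)
      then show ?thesis using \<open>\<delta> > 0\<close> by (simp add: algebra_simps)
    qed
    obtain U where U: "openin T U" "\<one>\<^bsub>G\<^esub> \<in> U"
      "\<And>g x. g \<in> U \<Longrightarrow> x \<in> carrier G \<Longrightarrow> \<bar>f (g \<otimes>\<^bsub>G\<^esub> x) - f x\<bar> \<le> \<delta>"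
      using rucb_unif[OF f \<open>\<delta> > 0\<close>] by blast
    obtain V where V: "openin T V" "\<one>\<^bsub>G\<^esub> \<in> V"
      "\<And>g x. g \<in> V \<Longrightarrow> x \<in> carrier G \<Longrightarrow> \<bar>h (g \<otimes>\<^bsub>G\<^esub> x) - h x\<bar> \<le> \<delta>"
      using rucb_unif[OF h \<open>\<delta> > 0\<close>] by blast
    have "\<bar>a * f (g \<otimes>\<^bsub>G\<^esub> x) + b * h (g \<otimes>\<^bsub>G\<^esub> x) - (a * f x + b * h x)\<bar> \<le> \<epsilon>"
      if "g \<in> U \<inter> V" "x \<in> carrier G" for g x
      using order_trans[OF lin[OF U(3) V(3)] \<delta>, of g x g x] that by (simp add: algebra_simps)
    then show "\<exists>U. openin T U \<and> \<one>\<^bsub>G\<^esub> \<in> U \<and> (\<forall>g\<in>U. \<forall>x\<in>carrier G.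
        \<bar>a * f (g \<otimes>\<^bsub>G\<^esub> x) + b * h (g \<otimes>\<^bsub>G\<^esub> x) - (a * f x + b * h x)\<bar> \<le> \<epsilon>)"
      using U V by (intro exI[of _ "U \<inter> V"]) auto
  qed
qed

lemma rucb_square:
  assumes f: "rucb G T f" and cl: "\<And>g x. g \<in> topspace T \<Longrightarrow> x \<in> carrier G \<Longrightarrow> g \<otimes>\<^bsub>G\<^esub> x \<in> carrier G"
  shows "rucb G T (\<lambda>x. (f x)\<^sup>2)"
proof -
  obtain B where "B > 0" and B: "\<And>x. x \<in> carrier G \<Longrightarrow> \<bar>f x\<bar> \<le> B" using rucb_bound[OF f] by metis
  show ?thesis
  proof (rule rucbI)
    show "\<bar>(f x)\<^sup>2\<bar> \<le> B\<^sup>2" if "x \<in> carrier G" for x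
      using power_mono[OF B[OF that], of 2] by simp
  next
    fix \<epsilon> :: real assume "\<epsilon> > 0"
    then have "\<epsilon> / (2 * B) > 0" using \<open>B > 0\<close> by simp
    then obtain U where U: "openin T U" "\<one>\<^bsub>G\<^esub> \<in> U"
      "\<And>g x. g \<in> U \<Longrightarrow> x \<in> carrier G \<Longrightarrow> \<bar>f (g \<otimes>\<^bsub>G\<^esub> x) - f x\<bar> \<le> \<epsilon> / (2 * B)"
      using rucb_unif[OF f] by blast
    have "\<bar>(f (g \<otimes>\<^bsub>G\<^esub> x))\<^sup>2 - (f x)\<^sup>2\<bar> \<le> \<epsilon>" if "g \<in> U" "x \<in> carrier G" for g x
    proof -
      have "g \<otimes>\<^bsub>G\<^esub> x \<in> carrier G" using that cl openin_subset[OF U(1)] by blast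
      then have "\<bar>f (g \<otimes>\<^bsub>G\<^esub> x) + f x\<bar> \<le> 2 * B"
        using B[of x] B[of "g \<otimes>\<^bsub>G\<^esub> x"] that by linarith
      then have "\<bar>f (g \<otimes>\<^bsub>G\<^esub> x) - f x\<bar> * \<bar>f (g \<otimes>\<^bsub>G\<^esub> x) + f x\<bar> \<le> \<epsilon> / (2 * B) * (2 * B)"
        using U(3) that \<open>\<epsilon> > 0\<close> \<open>B > 0\<close> by (intro mult_mono) auto
      then show ?thesis
        using \<open>B > 0\<close> by (simp add: power2_eq_square square_diff_square_factored abs_mult mult.commute)
    qed
    then show "\<exists>U. openin T U \<and> \<one>\<^bsub>G\<^esub> \<in> U \<and>
        (\<forall>g\<in>U. \<forall>x\<in>carrier G. \<bar>(f (g \<otimes>\<^bsub>G\<^esub> x))\<^sup>2 - (f x)\<^sup>2\<bar> \<le> \<epsilon>)"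
      using U by blast
  qed
qed

section \<open>Conjugation, translates and restrictions to subgroups\<close>

context topological_group
begin

lemma openin_subset_carrier: "openin T U \<Longrightarrow> U \<subseteq> carrier G"
  using openin_subset topspace_eq by blast

lemma continuous_map_conjugation:
  assumes x: "x \<in> carrier G"
  shows "continuous_map T T (\<lambda>g. x \<otimes> g \<otimes> inv x)"
proof -
  have mult: "continuous_map T T (\<lambda>g. u g \<otimes> v g)"
    if "continuous_map T T u" "continuous_map T T v" for u v
    using continuous_map_compose[OF _ continuous_mult, of T "\<lambda>g. (u g, v g)"] that
    by (simp add: continuous_map_pairwise o_def)
  show ?thesis
    using x by (intro mult) (auto simp: topspace_eq)
qed

lemma conjugate_nbhd:
  assumes "openin T U" "\<one> \<in> U" "x \<in> carrier G"
  shows "openin T {g \<in> carrier G. x \<otimes> g \<otimes> inv x \<in> U}" "\<one> \<in> {g \<in> carrier G. x \<otimes> g \<otimes> inv x \<in> U}"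
  using openin_continuous_map_preimage[OF continuous_map_conjugation assms(1)] assms
  by (auto simp: topspace_eq)

lemma rucb_const: "rucb G T (\<lambda>_. c)"
  by (rule rucbI[of _ _ "\<bar>c\<bar>"]) (use openin_topspace[of T] in \<open>auto simp: topspace_eq\<close>)

lemma rucb_power2: "rucb G T f \<Longrightarrow> rucb G T (\<lambda>x. (f x)\<^sup>2)"
  by (rule rucb_square) (auto simp: topspace_eq)

lemma rucb_add_const: "rucb G T f \<Longrightarrow> rucb G T (\<lambda>x. a * f x + b)"
  using rucb_lincomb[of G T f "\<lambda>_. 1" a b] rucb_const by simp

text \<open>Since \<open>a \<otimes> (g \<otimes> x) = (a \<otimes> g \<otimes> inv a) \<otimes> (a
  \<otimes> x)\<close>, a neighbourhood that works for \<open>f\<close> is replaced by its preimage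
  under conjugation by \<open>a\<close>, which is again open and contains
  \<open>\<one>\<close>.\<close>

lemma rucb_translate:
  assumes f: "rucb G T f" and a: "a \<in> carrier G"
  shows "rucb G T (\<lambda>x. f (a \<otimes> x))"
proof -
  obtain B where B: "\<And>x. x \<in> carrier G \<Longrightarrow> \<bar>f x\<bar> \<le> B" using rucb_bound[OF f] by metis
  show ?thesis
  proof (rule rucbI)
    show "\<bar>f (a \<otimes> x)\<bar> \<le> B" if "x \<in> carrier G" for x using B a that by blast
  next
    fix \<epsilon> :: real assume "\<epsilon> > 0"
    then obtain U where U: "openin T U" "\<one> \<in> U"
      "\<And>g x. g \<in> U \<Longrightarrow> x \<in> carrier G \<Longrightarrow> \<bar>f (g \<otimes> x) - f x\<bar> \<le> \<epsilon>"
      using rucb_unif[OF f] by blast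
    have "\<bar>f (a \<otimes> (g \<otimes> x)) - f (a \<otimes> x)\<bar> \<le> \<epsilon>"
      if "g \<in> {g \<in> carrier G. a \<otimes> g \<otimes> inv a \<in> U}" "x \<in> carrier G" for g x
    proof -
      have "inv a \<otimes> (a \<otimes> x) = x" using that a by (simp flip: m_assoc)
      then have "a \<otimes> g \<otimes> inv a \<otimes> (a \<otimes> x) = a \<otimes> (g \<otimes> x)" using that a by (simp add: m_assoc)
      then show ?thesis using U(3)[of "a \<otimes> g \<otimes> inv a" "a \<otimes> x"] that a by simp
    qed
    then show "\<exists>U. openin T U \<and> \<one> \<in> U \<and>
        (\<forall>g\<in>U. \<forall>x\<in>carrier G. \<bar>f (a \<otimes> (g \<otimes> x)) - f (a \<otimes> x)\<bar> \<le> \<epsilon>)"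
      using conjugate_nbhd[OF U(1,2) a] by blast
  qed
qed

text \<open>Combined with translation by \<open>x\<close>, this makes
  \<open>h \<mapsto> f (x \<otimes> h)\<close> an admissible argument for an invariant mean on
  \<open>K\<close>.\<close>

lemma restrict_rucb_in_RUCB:
  assumes f: "rucb G T f" and K: "subgroup K G"
  shows "restrict f K \<in> RUCB (G\<lparr>carrier := K\<rparr>) (subtopology T K)"
proof -
  obtain B where B: "\<And>x. x \<in> carrier G \<Longrightarrow> \<bar>f x\<bar> \<le> B" using rucb_bound[OF f] by metis
  note KG = subgroup.mem_carrier[OF K]
  have "\<exists>U. nbhd_of (subtopology T K) \<one> U \<and>
      (\<forall>g\<in>U. (SUP x\<in>K. \<bar>restrict f K x - restrict f K (g \<otimes> x)\<bar>) \<le> \<epsilon>)" if \<epsilon>: "\<epsilon> > 0" for \<epsilon>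
  proof -
    obtain U where U: "openin T U" "\<one> \<in> U"
      "\<And>g x. g \<in> U \<Longrightarrow> x \<in> carrier G \<Longrightarrow> \<bar>f (g \<otimes> x) - f x\<bar> \<le> \<epsilon>"
      using rucb_unif[OF f \<epsilon>] by blast
    have "openin (subtopology T K) (U \<inter> K)" using U(1) by (auto simp: openin_subtopology)
    then have "nbhd_of (subtopology T K) \<one> (U \<inter> K)"
      using openin_subset[of "subtopology T K" "U \<inter> K"] U(2) subgroup.one_closed[OF K]
      unfolding nbhd_of_def by blast
    moreover have "(SUP x\<in>K. \<bar>restrict f K x - restrict f K (g \<otimes> x)\<bar>) \<le> \<epsilon>" if "g \<in> U \<inter> K" for g
    proof (rule cSUP_least)
      show "K \<noteq> {}" using subgroup.one_closed[OF K] by blast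
      show "\<bar>restrict f K x - restrict f K (g \<otimes> x)\<bar> \<le> \<epsilon>" if "x \<in> K" for x
        using U(3)[of g x] that \<open>g \<in> U \<inter> K\<close> K KG
        by (simp add: subgroup.m_closed abs_minus_commute)
    qed
    ultimately show ?thesis by blast
  qed
  moreover have "\<exists>B. \<forall>x\<in>K. \<bar>restrict f K x\<bar> \<le> B"
    using B KG by (intro exI[of _ B]) auto
  ultimately show ?thesis
    unfolding RUCB_def by simp
qed

end

section \<open>Averaging operators\<close>

text \<open>
  \<open>P f x\<close> plays the role of the average of \<open>f\<close> over the left coset \<open>x K\<close>; accordingly
  positivity is only required to depend on the values of \<open>f\<close> on that coset.
\<close>

locale averaging_operator = topological_group +
  fixes K :: "'a set" and P :: "('a \<Rightarrow> real) \<Rightarrow> 'a \<Rightarrow> real"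
  assumes K: "subgroup K G"
    and lincomb: "\<lbrakk>rucb G T f; rucb G T h; x \<in> carrier G\<rbrakk> \<Longrightarrow>
      P (\<lambda>y. a * f y + b * h y) x = a * P f x + b * P h x"
    and nonneg: "\<lbrakk>rucb G T f; x \<in> carrier G; \<And>h. h \<in> K \<Longrightarrow> 0 \<le> f (x \<otimes> h)\<rbrakk> \<Longrightarrow> 0 \<le> P f x"
    and one: "x \<in> carrier G \<Longrightarrow> P (\<lambda>_. 1) x = 1"
    and translate: "\<lbrakk>rucb G T f; g \<in> carrier G; x \<in> carrier G\<rbrakk> \<Longrightarrow>
      P (\<lambda>y. f (g \<otimes> y)) x = P f (g \<otimes> x)"
    and invariant: "\<lbrakk>rucb G T f; x \<in> carrier G; k \<in> K\<rbrakk> \<Longrightarrow> P f (x \<otimes> k) = P f x"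
begin

lemma affine:
  assumes "rucb G T f" "x \<in> carrier G"
  shows "P (\<lambda>y. a * f y + b) x = a * P f x + b"
  using lincomb[of f "\<lambda>_. 1" x a b] assms rucb_const one by simp

lemma mono:
  assumes f: "rucb G T f" and h: "rucb G T h" and x: "x \<in> carrier G"
    and le: "\<And>k. k \<in> K \<Longrightarrow> f (x \<otimes> k) \<le> h (x \<otimes> k)"
  shows "P f x \<le> P h x"
  using nonneg[of "\<lambda>y. 1 * h y + (-1) * f y" x] lincomb[OF h f x, of 1 "-1"]
    rucb_lincomb[OF h f, of 1 "-1"] x le by simp

lemma le_const:
  assumes "rucb G T f" "x \<in> carrier G" "\<And>k. k \<in> K \<Longrightarrow> f (x \<otimes> k) \<le> c"
  shows "P f x \<le> c"
  using mono[of f "\<lambda>_. c" x] affine[of "\<lambda>_. 1" x 0 c] assms rucb_const by simp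

lemma ge_const:
  assumes "rucb G T f" "x \<in> carrier G" "\<And>k. k \<in> K \<Longrightarrow> c \<le> f (x \<otimes> k)"
  shows "c \<le> P f x"
  using mono[of "\<lambda>_. c" f x] affine[of "\<lambda>_. 1" x 0 c] assms rucb_const by simp

text \<open>Because \<open>P\<close> commutes with left translation, the difference in question is
  the average of \<open>f (g \<otimes> y) - f y\<close>, and a positive unital operator keeps the
  bounds of its argument. Both the uniform continuity of \<open>P f\<close> and the preservation of
  Lipschitz constants rest on this estimate.\<close>

lemma displacement_le:
  assumes f: "rucb G T f" and g: "g \<in> carrier G" and x: "x \<in> carrier G"
    and r: "\<And>y. y \<in> carrier G \<Longrightarrow> \<bar>f (g \<otimes> y) - f y\<bar> \<le> r"
  shows "\<bar>P f (g \<otimes> x) - P f x\<bar> \<le> r"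
proof -
  let ?u = "\<lambda>y. 1 * f (g \<otimes> y) + (-1) * f y"
  note fg = rucb_translate[OF f g]
  have u: "rucb G T ?u" using rucb_lincomb[OF fg f, of 1 "-1"] .
  have eq: "P ?u x = P f (g \<otimes> x) - P f x"
    using lincomb[OF fg f x, of 1 "-1"] translate[OF f g x] by simp
  have *: "\<bar>?u (x \<otimes> k)\<bar> \<le> r" if "k \<in> K" for k
    using r[of "x \<otimes> k"] x subgroup.mem_carrier[OF K that] by simp
  have "P ?u x \<le> r" using * by (intro le_const[OF u x]) (auto simp: abs_le_iff)
  moreover have "- r \<le> P ?u x" using * by (intro ge_const[OF u x]) (force simp: abs_le_iff)
  ultimately show ?thesis using eq by linarith
qed

lemma rucb_average:
  assumes f: "rucb G T f"
  shows "rucb G T (P f)"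
proof -
  obtain B where B: "\<And>x. x \<in> carrier G \<Longrightarrow> \<bar>f x\<bar> \<le> B" using rucb_bound[OF f] by metis
  show ?thesis
  proof (rule rucbI)
    fix x assume x: "x \<in> carrier G"
    have *: "\<bar>f (x \<otimes> k)\<bar> \<le> B" if "k \<in> K" for k
      using B[of "x \<otimes> k"] x subgroup.mem_carrier[OF K that] by simp
    have "P f x \<le> B" using * by (intro le_const[OF f x]) (auto simp: abs_le_iff)
    moreover have "- B \<le> P f x" using * by (intro ge_const[OF f x]) (force simp: abs_le_iff)
    ultimately show "\<bar>P f x\<bar> \<le> B" by linarith
  next
    fix \<epsilon> :: real assume "\<epsilon> > 0"
    then obtain U where U: "openin T U" "\<one> \<in> U"
      "\<And>g x. g \<in> U \<Longrightarrow> x \<in> carrier G \<Longrightarrow> \<bar>f (g \<otimes> x) - f x\<bar> \<le> \<epsilon>"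
      using rucb_unif[OF f] by blast
    then have "\<forall>g\<in>U. \<forall>x\<in>carrier G. \<bar>P f (g \<otimes> x) - P f x\<bar> \<le> \<epsilon>"
      using openin_subset_carrier by (blast intro: displacement_le[OF f])
    then show "\<exists>U. openin T U \<and> \<one> \<in> U \<and>
        (\<forall>g\<in>U. \<forall>x\<in>carrier G. \<bar>P f (g \<otimes> x) - P f x\<bar> \<le> \<epsilon>)"
      using U by blast
  qed
qed

text \<open>The average \<open>m\<close> of \<open>f\<close> over the coset \<open>x K\<close> lies
  within \<open>c\<close> of every value of \<open>f\<close> there. Expanding
  \<open>(f y - m)\<^sup>2 \<le> c\<^sup>2\<close> bounds \<open>(f y)\<^sup>2\<close> by an affine
  function of \<open>f y\<close>, which \<open>P\<close> averages exactly.\<close>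

lemma variance_le:
  assumes f: "rucb G T f" and x: "x \<in> carrier G"
    and c: "\<And>h k. h \<in> K \<Longrightarrow> k \<in> K \<Longrightarrow> f (x \<otimes> h) \<le> f (x \<otimes> k) + c"
  shows "P (\<lambda>y. (f y)\<^sup>2) x \<le> (P f x)\<^sup>2 + c\<^sup>2"
proof -
  define m where "m = P f x"
  have "P (\<lambda>y. (f y)\<^sup>2) x \<le> P (\<lambda>y. (2 * m) * f y + (c\<^sup>2 - m\<^sup>2)) x"
  proof (rule mono)
    show "rucb G T (\<lambda>y. (f y)\<^sup>2)" using rucb_power2[OF f] .
    show "rucb G T (\<lambda>y. (2 * m) * f y + (c\<^sup>2 - m\<^sup>2))" using rucb_add_const[OF f] .
    fix h assume h: "h \<in> K"
    have "m \<le> f (x \<otimes> h) + c" unfolding m_def using c h by (intro le_const[OF f x]) auto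
    moreover have "f (x \<otimes> h) - c \<le> m"
      unfolding m_def using c[OF h] by (intro ge_const[OF f x]) (auto simp: algebra_simps)
    ultimately have "\<bar>f (x \<otimes> h) - m\<bar> \<le> c" by linarith
    then have "(f (x \<otimes> h) - m)\<^sup>2 \<le> c\<^sup>2"
      using power_mono[of "\<bar>f (x \<otimes> h) - m\<bar>" c 2] by simp
    then show "(f (x \<otimes> h))\<^sup>2 \<le> (2 * m) * f (x \<otimes> h) + (c\<^sup>2 - m\<^sup>2)"
      by (simp add: power2_diff algebra_simps)
  qed (fact x)
  also have "\<dots> = m\<^sup>2 + c\<^sup>2"
    using affine[OF f x] by (simp add: m_def power2_eq_square)
  finally show ?thesis by (simp add: m_def)
qed

end

text \<open>Averaging over cosets of \<open>K\<close> first is harmless because, with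
  \<open>K \<subseteq> L\<close>, each coset of \<open>L\<close> is a union of cosets of
  \<open>K\<close>; so positivity still depends only on the values on \<open>x L\<close>.\<close>

lemma averaging_operator_compose:
  assumes "averaging_operator G T K P" "averaging_operator G T L Q" "K \<subseteq> L"
  shows "averaging_operator G T L (\<lambda>f. Q (P f))"
proof -
  interpret P: averaging_operator G T K P by fact
  interpret Q: averaging_operator G T L Q by fact
  note LG = subgroup.mem_carrier[OF Q.K]
  \<comment> \<open>The laws of \<open>P\<close> hold only at points of \<open>carrier G\<close>, so
    they cannot be rewritten under \<open>Q\<close> as equations of functions; monotonicity of
    \<open>Q\<close> in both directions bridges this.\<close>
  have cong: "Q f x = Q h x"
    if "rucb G T f" "rucb G T h" "x \<in> carrier G" "\<And>y. y \<in> carrier G \<Longrightarrow> f y = h y" for f h x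
    using that LG by (intro order.antisym Q.mono) auto
  show ?thesis
  proof (intro averaging_operator.intro averaging_operator_axioms.intro)
    show "topological_group G T" by unfold_locales
    show "subgroup L G" by (fact Q.K)
    fix f x assume f: "rucb G T f" and x: "x \<in> carrier G"
    show "Q (P (\<lambda>y. a * f y + b * h y)) x = a * Q (P f) x + b * Q (P h) x"
      if h: "rucb G T h" for h a b
    proof -
      have "Q (P (\<lambda>y. a * f y + b * h y)) x = Q (\<lambda>y. a * P f y + b * P h y) x"
        using f h x by (intro cong P.rucb_average rucb_lincomb P.lincomb)
      also have "\<dots> = a * Q (P f) x + b * Q (P h) x"
        using f h x by (intro Q.lincomb P.rucb_average)
      finally show ?thesis .
    qed
    show "0 \<le> Q (P f) x" if "\<And>h. h \<in> L \<Longrightarrow> 0 \<le> f (x \<otimes>\<^bsub>G\<^esub> h)"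
    proof (intro Q.nonneg P.rucb_average P.nonneg f x)
      fix h assume h: "h \<in> L"
      then show "x \<otimes>\<^bsub>G\<^esub> h \<in> carrier G" using x LG by simp
      fix k assume k: "k \<in> K"
      show "0 \<le> f (x \<otimes>\<^bsub>G\<^esub> h \<otimes>\<^bsub>G\<^esub> k)"
        using that[of "h \<otimes>\<^bsub>G\<^esub> k"] h k assms(3) x LG subgroup.m_closed[OF Q.K]
        by (simp add: P.m_assoc subset_iff)
    qed
    show "Q (P (\<lambda>y. f (g \<otimes>\<^bsub>G\<^esub> y))) x = Q (P f) (g \<otimes>\<^bsub>G\<^esub> x)" if g: "g \<in> carrier G" for g
    proof -
      have "Q (P (\<lambda>y. f (g \<otimes>\<^bsub>G\<^esub> y))) x = Q (\<lambda>y. P f (g \<otimes>\<^bsub>G\<^esub> y)) x"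
        using f g x by (intro cong P.rucb_average P.rucb_translate P.translate)
      also have "\<dots> = Q (P f) (g \<otimes>\<^bsub>G\<^esub> x)" using f g x by (intro Q.translate P.rucb_average)
      finally show ?thesis .
    qed
    show "Q (P f) (x \<otimes>\<^bsub>G\<^esub> k) = Q (P f) x" if "k \<in> L" for k
      using f x that by (intro Q.invariant P.rucb_average)
  next
    fix x assume x: "x \<in> carrier G"
    have "Q (P (\<lambda>_. 1)) x = Q (\<lambda>_. 1) x"
      using x by (intro cong P.rucb_average P.rucb_const P.one)
    then show "Q (P (\<lambda>_. 1)) x = 1" using Q.one[OF x] by simp
  qed
qed

lemma (in topological_group) averaging_operator_trivial:
  "averaging_operator G T {\<one>} (\<lambda>f. f)"
proof (intro averaging_operator.intro averaging_operator_axioms.intro)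
  show "topological_group G T" by unfold_locales
  show "subgroup {\<one>} G" by (rule triv_subgroup)
qed auto

text \<open>The mean of \<open>K\<close> is applied to \<open>h \<mapsto> f (x \<otimes> h)\<close>.
  Replacing \<open>x\<close> by \<open>x \<otimes> k\<close> translates this function on the left by
  \<open>k\<close>, so left invariance of the mean makes the result depend on the coset only.
  Translating \<open>f\<close> by \<open>g\<close> merely moves \<open>x\<close> to
  \<open>g \<otimes> x\<close>, by associativity.\<close>

lemma (in topological_group) amenable_subgroup_averaging:
  assumes "K \<in> amenable_subgroups G T"
  obtains P where "averaging_operator G T K P"
proof -
  from assms have K: "subgroup K G" and "amenable (G\<lparr>carrier := K\<rparr>) (subtopology T K)"
    by (auto simp: amenable_subgroups_def)
  then obtain \<mu> :: "('a \<Rightarrow> real) \<Rightarrow> real" where \<mu>: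
    "\<forall>f\<in>RUCB (G\<lparr>carrier := K\<rparr>) (subtopology T K). \<forall>h\<in>RUCB (G\<lparr>carrier := K\<rparr>) (subtopology T K).
      \<forall>a b. \<mu> (\<lambda>x\<in>K. a * f x + b * h x) = a * \<mu> f + b * \<mu> h"
    "\<forall>f\<in>RUCB (G\<lparr>carrier := K\<rparr>) (subtopology T K). (\<forall>x\<in>K. 0 \<le> f x) \<longrightarrow> 0 \<le> \<mu> f"
    "\<mu> (\<lambda>x\<in>K. 1) = 1"
    "\<forall>f\<in>RUCB (G\<lparr>carrier := K\<rparr>) (subtopology T K). \<forall>g\<in>K. \<mu> (\<lambda>x\<in>K. f (g \<otimes> x)) = \<mu> f"
    unfolding amenable_def by auto
  define P where "P f x = \<mu> (\<lambda>h\<in>K. f (x \<otimes> h))" for f x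
  note KG = subgroup.mem_carrier[OF K]
  have R: "(\<lambda>h\<in>K. f (x \<otimes> h)) \<in> RUCB (G\<lparr>carrier := K\<rparr>) (subtopology T K)"
    if "rucb G T f" "x \<in> carrier G" for f x
    using restrict_rucb_in_RUCB[OF rucb_translate[OF that] K] .
  have "averaging_operator G T K P"
  proof (intro averaging_operator.intro averaging_operator_axioms.intro)
    show "topological_group G T" by unfold_locales
    show "subgroup K G" by fact
    fix f x assume f: "rucb G T f" and x: "x \<in> carrier G"
    show "P (\<lambda>y. a * f y + b * h y) x = a * P f x + b * P h x" if h: "rucb G T h" for h a b
    proof -
      have eq: "(\<lambda>u\<in>K. a * (\<lambda>h\<in>K. f (x \<otimes> h)) u + b * (\<lambda>k\<in>K. h (x \<otimes> k)) u)
          = (\<lambda>u\<in>K. a * f (x \<otimes> u) + b * h (x \<otimes> u))" by auto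
      show ?thesis using bspec[OF bspec[OF \<mu>(1) R[OF f x]] R[OF h x]] unfolding P_def eq[symmetric] by blast
    qed
    show "0 \<le> P f x" if "\<And>h. h \<in> K \<Longrightarrow> 0 \<le> f (x \<otimes> h)"
      unfolding P_def using that bspec[OF \<mu>(2) R[OF f x]] by simp
    show "P (\<lambda>y. f (g \<otimes> y)) x = P f (g \<otimes> x)" if g: "g \<in> carrier G" for g
    proof -
      have "(\<lambda>h\<in>K. f (g \<otimes> (x \<otimes> h))) = (\<lambda>h\<in>K. f (g \<otimes> x \<otimes> h))"
        using g x KG by (auto simp: m_assoc)
      then show ?thesis by (simp add: P_def)
    qed
    show "P f (x \<otimes> k) = P f x" if k: "k \<in> K" for k
    proof -
      have "(\<lambda>u\<in>K. (\<lambda>h\<in>K. f (x \<otimes> h)) (k \<otimes> u)) = (\<lambda>h\<in>K. f (x \<otimes> k \<otimes> h))"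
        using k x KG subgroup.m_closed[OF K] by (auto simp: m_assoc)
      then show ?thesis using bspec[OF bspec[OF \<mu>(4) R[OF f x]] k] by (simp add: P_def)
    qed
  next
    show "P (\<lambda>_. 1) x = 1" for x by (simp add: P_def \<mu>(3))
  qed
  then show ?thesis by (rule that)
qed

section \<open>Variance along a chain of amenable subgroups\<close>

lemma DeltaD:
  assumes "d \<in> Delta G T" "x \<in> carrier G" "y \<in> carrier G"
  shows Delta_refl: "d x x = 0" and Delta_nonneg: "0 \<le> d x y" and Delta_commute: "d x y = d y x"
    and Delta_triangle: "z \<in> carrier G \<Longrightarrow> d x z \<le> d x y + d y z"
    and Delta_right_invariant: "z \<in> carrier G \<Longrightarrow> d (x \<otimes>\<^bsub>G\<^esub> z) (y \<otimes>\<^bsub>G\<^esub> z) = d x y"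
  using assms by (auto simp: Delta_def pseudometric_on_def)

lemma Delta_bound:
  assumes "d \<in> Delta G T"
  obtains B where "\<And>x y. x \<in> carrier G \<Longrightarrow> y \<in> carrier G \<Longrightarrow> d x y \<le> B"
proof -
  from assms have "\<exists>B. \<forall>x\<in>carrier G. \<forall>y\<in>carrier G. d x y \<le> B" by (simp add: Delta_def)
  then show ?thesis using that by blast
qed

lemma Delta_scale:
  assumes d: "d \<in> Delta G T" and c: "c > 0"
  shows "(\<lambda>x y. c * d x y) \<in> Delta G T"
proof -
  obtain B where B: "\<And>x y. x \<in> carrier G \<Longrightarrow> y \<in> carrier G \<Longrightarrow> d x y \<le> B"
    using Delta_bound[OF d] by metis
  have "pseudometric_on (carrier G) (\<lambda>x y. c * d x y)"
    using c DeltaD[OF d] by (auto simp: pseudometric_on_def simp flip: distrib_left)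
  moreover have "\<exists>B. \<forall>x\<in>carrier G. \<forall>y\<in>carrier G. c * d x y \<le> B"
    using B c by (intro exI[of _ "c * B"]) simp
  moreover have "openin (pseudometric_topology (carrier G) d) U"
    if "openin (pseudometric_topology (carrier G) (\<lambda>x y. c * d x y)) U" for U
    unfolding openin_pseudometric_topology
  proof (intro conjI ballI)
    show "U \<subseteq> carrier G" using that by (simp add: openin_pseudometric_topology)
    fix x assume "x \<in> U"
    then have "\<exists>r>0. {y \<in> carrier G. c * d x y < r} \<subseteq> U"
      using that by (simp add: openin_pseudometric_topology)
    then obtain r where "r > 0" "{y \<in> carrier G. c * d x y < r} \<subseteq> U"
      by blast
    then show "\<exists>r>0. {y \<in> carrier G. d x y < r} \<subseteq> U"
      using c by (intro exI[of _ "r / c"]) (auto simp: field_simps)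
  qed
  moreover have "openin T U" if "openin (pseudometric_topology (carrier G) d) U" for U
    using d that by (simp add: Delta_def)
  ultimately show ?thesis
    using Delta_right_invariant[OF d] by (simp add: Delta_def)
qed

section \<open>Diameters of coset spaces\<close>

lemma (in group) lcosets_subset_eq:
  "lcosets\<^bsub>G\<lparr>carrier := L\<rparr>\<^esub> K = (\<lambda>h. h <#\<^bsub>G\<^esub> K) ` L"
  by (auto simp: LCOSETS_def l_coset_def)

context group
begin

context
  fixes T d K L
  assumes d: "d \<in> Delta G T" and K: "subgroup K G" and L: "L \<subseteq> carrier G"
begin

text \<open>The upper bound comes from the choice \<open>u = \<one>\<close>. These bounds supply the
  boundedness conditions for the real suprema that follow.\<close>

lemma INF_coset_dist_bounds:
  assumes "x \<in> carrier G" "h \<in> L" "k \<in> L" and B: "\<And>x y. x \<in> carrier G \<Longrightarrow> y \<in> carrier G \<Longrightarrow> d x y \<le> B"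
  shows "0 \<le> (INF u\<in>K. d (x \<otimes> h) (x \<otimes> (k \<otimes> u)))" "(INF u\<in>K. d (x \<otimes> h) (x \<otimes> (k \<otimes> u))) \<le> B"
proof -
  note [simp] = subgroup.mem_carrier[OF K]
  have [simp]: "h \<in> carrier G" "k \<in> carrier G" using assms L by auto
  have nn: "0 \<le> d (x \<otimes> h) (x \<otimes> (k \<otimes> u))" if "u \<in> K" for u
    using Delta_nonneg[OF d] that assms(1) by simp
  then show "0 \<le> (INF u\<in>K. d (x \<otimes> h) (x \<otimes> (k \<otimes> u)))"
    using subgroup.one_closed[OF K] by (intro cINF_greatest) auto
  have "(INF u\<in>K. d (x \<otimes> h) (x \<otimes> (k \<otimes> u))) \<le> d (x \<otimes> h) (x \<otimes> (k \<otimes> \<one>))"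
    using subgroup.one_closed[OF K] nn by (intro cINF_lower bdd_belowI2[of _ 0]) auto
  also have "\<dots> \<le> B" using B assms(1) by simp
  finally show "(INF u\<in>K. d (x \<otimes> h) (x \<otimes> (k \<otimes> u))) \<le> B" .
qed

text \<open>Passing to representatives removes the definite description in
  \<open>coset_dist\<close>.\<close>

lemma coset_diam_eq:
  assumes "g \<in> carrier G"
  shows "coset_diam G d L K g = (SUP (h, k)\<in>L \<times> L. INF u\<in>K. d (g \<otimes> h) (g \<otimes> (k \<otimes> u)))"
proof -
  have "coset_diam G d L K g =
      (SUP (h, k)\<in>L \<times> L. coset_dist G d K g (h <# K) (k <# K))"
    unfolding coset_diam_def lcosets_subset_eq by (simp add: image_image case_prod_beta flip: map_prod_surj_on)
  also have "\<dots> = (SUP (h, k)\<in>L \<times> L. INF u\<in>K. d (g \<otimes> h) (g \<otimes> (k \<otimes> u)))"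
    using coset_dist_eq[OF is_group K d assms] L by (intro SUP_cong) auto
  finally show ?thesis .
qed

lemma coset_diam_upper:
  assumes "x \<in> carrier G" "h \<in> L" "k \<in> L"
  shows "(INF u\<in>K. d (x \<otimes> h) (x \<otimes> (k \<otimes> u))) \<le> (SUP g\<in>carrier G. coset_diam G d L K g)"
proof -
  obtain B where B: "\<And>x y. x \<in> carrier G \<Longrightarrow> y \<in> carrier G \<Longrightarrow> d x y \<le> B"
    using Delta_bound[OF d] by metis
  have "(INF u\<in>K. d (x \<otimes> h) (x \<otimes> (k \<otimes> u))) \<le> coset_diam G d L K x"
    unfolding coset_diam_eq[OF assms(1)]
    using assms INF_coset_dist_bounds(2)[OF assms(1) _ _ B]
    by (intro cSUP_upper2[of _ _ "(h, k)"] bdd_aboveI2[of _ _ B]) auto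
  also have "\<dots> \<le> (SUP g\<in>carrier G. coset_diam G d L K g)"
  proof (intro cSUP_upper bdd_aboveI2 assms(1))
    fix g assume g: "g \<in> carrier G"
    show "coset_diam G d L K g \<le> B"
      unfolding coset_diam_eq[OF g]
      using assms INF_coset_dist_bounds(2)[OF g _ _ B] by (intro cSUP_least) auto
  qed
  finally show ?thesis .
qed

lemma coset_diam_least:
  assumes "L \<noteq> {}"
    and "\<And>x h k. x \<in> carrier G \<Longrightarrow> h \<in> L \<Longrightarrow> k \<in> L \<Longrightarrow> (INF u\<in>K. d (x \<otimes> h) (x \<otimes> (k \<otimes> u))) \<le> r"
  shows "(SUP g\<in>carrier G. coset_diam G d L K g) \<le> r"
proof (rule cSUP_least)
  fix g assume g: "g \<in> carrier G"
  show "coset_diam G d L K g \<le> r"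
    unfolding coset_diam_eq[OF g] using assms g by (intro cSUP_least) auto
qed auto

lemma coset_diam_nonneg:
  assumes "L \<noteq> {}"
  shows "0 \<le> (SUP g\<in>carrier G. coset_diam G d L K g)"
proof -
  obtain B where B: "\<And>x y. x \<in> carrier G \<Longrightarrow> y \<in> carrier G \<Longrightarrow> d x y \<le> B"
    using Delta_bound[OF d] by metis
  obtain h where "h \<in> L" using assms by blast
  then show ?thesis
    using INF_coset_dist_bounds(1)[OF one_closed _ _ B] coset_diam_upper[OF one_closed]
    by (meson order_trans)
qed

text \<open>Right \<open>K\<close>-invariance allows \<open>k\<close> to be replaced by
  \<open>k \<otimes> u\<close> for every \<open>u\<close> in \<open>K\<close>. The Lipschitz bound
  can therefore be minimised over \<open>u\<close>, which turns it into a coset distance.\<close>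

lemma lipschitz_oscillation_le:
  assumes "c > 0" and lip: "\<And>x y. x \<in> carrier G \<Longrightarrow> y \<in> carrier G \<Longrightarrow> \<bar>f x - f y\<bar> \<le> c * d x y"
    and inv: "\<And>x k. x \<in> carrier G \<Longrightarrow> k \<in> K \<Longrightarrow> f (x \<otimes> k) = f x"
    and x: "x \<in> carrier G" and h: "h \<in> L" and k: "k \<in> L"
  shows "f (x \<otimes> h) \<le> f (x \<otimes> k) + c * (SUP g\<in>carrier G. coset_diam G d L K g)"
proof -
  note [simp] = subgroup.mem_carrier[OF K]
  have [simp]: "h \<in> carrier G" "k \<in> carrier G" using h k L by auto
  \<comment> \<open>Dividing by \<open>c\<close> first avoids moving a factor through the
    infimum.\<close>
  have "(f (x \<otimes> h) - f (x \<otimes> k)) / c \<le> (INF u\<in>K. d (x \<otimes> h) (x \<otimes> (k \<otimes> u)))"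
  proof (rule cINF_greatest)
    show "K \<noteq> {}" using subgroup.one_closed[OF K] by blast
    fix u assume u: "u \<in> K"
    have "f (x \<otimes> k) = f (x \<otimes> (k \<otimes> u))" using inv[of "x \<otimes> k" u] x u by (simp add: m_assoc)
    moreover have "\<bar>f (x \<otimes> h) - f (x \<otimes> (k \<otimes> u))\<bar> \<le> c * d (x \<otimes> h) (x \<otimes> (k \<otimes> u))"
      using lip x u by simp
    ultimately have "f (x \<otimes> h) - f (x \<otimes> k) \<le> c * d (x \<otimes> h) (x \<otimes> (k \<otimes> u))" by linarith
    then show "(f (x \<otimes> h) - f (x \<otimes> k)) / c \<le> d (x \<otimes> h) (x \<otimes> (k \<otimes> u))"
      using \<open>c > 0\<close> by (simp add: field_simps)
  qed
  also note coset_diam_upper[OF x h k]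
  finally show ?thesis using \<open>c > 0\<close> by (simp add: field_simps)
qed

lemma coset_diam_scale_le:
  assumes "c > 0" "L \<noteq> {}"
  shows "(SUP g\<in>carrier G. coset_diam G (\<lambda>x y. c * d x y) L K g)
    \<le> c * (SUP g\<in>carrier G. coset_diam G d L K g)"
proof (rule group.coset_diam_least[OF is_group Delta_scale[OF d \<open>c > 0\<close>] K L \<open>L \<noteq> {}\<close>])
  fix x h k assume xhk: "x \<in> carrier G" "h \<in> L" "k \<in> L"
  note [simp] = subgroup.mem_carrier[OF K]
  have [simp]: "h \<in> carrier G" "k \<in> carrier G" using xhk L by auto
  let ?I = "INF u\<in>K. c * d (x \<otimes> h) (x \<otimes> (k \<otimes> u))"
  have "?I / c \<le> (INF u\<in>K. d (x \<otimes> h) (x \<otimes> (k \<otimes> u)))"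
  proof (rule cINF_greatest)
    show "K \<noteq> {}" using subgroup.one_closed[OF K] by blast
    fix u assume "u \<in> K"
    then have "?I \<le> c * d (x \<otimes> h) (x \<otimes> (k \<otimes> u))"
      using Delta_nonneg[OF d] xhk(1) \<open>c > 0\<close> by (intro cINF_lower bdd_belowI2[of _ 0]) auto
    then show "?I / c \<le> d (x \<otimes> h) (x \<otimes> (k \<otimes> u))" using \<open>c > 0\<close> by (simp add: field_simps)
  qed
  also note coset_diam_upper[OF xhk]
  finally show "?I \<le> c * (SUP g\<in>carrier G. coset_diam G d L K g)"
    using \<open>c > 0\<close> by (simp add: field_simps)
qed

end

end

section \<open>Lengths of chains and their behaviour under rescaling\<close>

lemma amenable_chainsD:
  assumes "Gs \<in> amenable_chains G T"
  shows "0 < length Gs" "Gs ! 0 = {\<one>\<^bsub>G\<^esub>}" "Gs ! (length Gs - 1) = carrier G"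
    and "i < length Gs \<Longrightarrow> Gs ! i \<in> amenable_subgroups G T"
    and "i < length Gs \<Longrightarrow> subgroup (Gs ! i) G"
    and "Suc i < length Gs \<Longrightarrow> Gs ! i \<subseteq> Gs ! Suc i"
  using assms nth_mem[of i Gs]
  by (auto simp: amenable_chains_def amenable_subgroups_def hd_conv_nth last_conv_nth simp del: nth_mem)

lemma (in group) chain_length_scale_le:
  assumes d: "d \<in> Delta G T" and c: "c > 0" and Gs: "Gs \<in> amenable_chains G T"
  shows "chain_length G Gs (\<lambda>x y. c * d x y) \<le> c * chain_length G Gs d"
proof -
  let ?w = "\<lambda>d i. SUP g\<in>carrier G. coset_diam G d (Gs ! Suc i) (Gs ! i) g"
  let ?d = "\<lambda>x y. c * d x y"
  have "chain_length G Gs ?d \<le> sqrt (\<Sum>i<length Gs - 1. (c * ?w d i)\<^sup>2)"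
    unfolding chain_length_def
  proof (intro real_sqrt_le_mono sum_mono power_mono)
    fix i assume "i \<in> {..<length Gs - 1}"
    then have i: "i < length Gs" "Suc i < length Gs" by auto
    note K = amenable_chainsD(5)[OF Gs i(1)] and L = amenable_chainsD(5)[OF Gs i(2)]
    have ne: "Gs ! Suc i \<noteq> {}" using subgroup.one_closed[OF L] by blast
    show "?w ?d i \<le> c * ?w d i" using coset_diam_scale_le[OF d K subgroup.subset[OF L] c ne] .
    show "0 \<le> ?w ?d i" using coset_diam_nonneg[OF Delta_scale[OF d c] K subgroup.subset[OF L] ne] .
  qed
  also have "\<dots> = c * chain_length G Gs d"
    using c by (simp add: chain_length_def power_mult_distrib real_sqrt_mult flip: sum_distrib_left)
  finally show ?thesis .
qed

text \<open>An infimum over the empty set would be infinite, so vanishing length also provides the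
  existence of a chain.\<close>

lemma metric_amenable_length_zeroD:
  assumes "metric_amenable_length G T d = 0" "\<epsilon> > 0"
  obtains Gs where "Gs \<in> amenable_chains G T" "chain_length G Gs d < \<epsilon>"
proof -
  have "(INF Gs\<in>amenable_chains G T. ennreal (chain_length G Gs d)) < ennreal \<epsilon>"
    using assms by (simp add: metric_amenable_length_def)
  then show ?thesis
    using that \<open>\<epsilon> > 0\<close> by (auto simp: INF_less_iff ennreal_less_iff chain_length_def sum_nonneg)
qed

lemma (in group) metric_amenable_length_scale_zero:
  assumes d: "d \<in> Delta G T" and "metric_amenable_length G T d = 0" and c: "c > 0"
  shows "metric_amenable_length G T (\<lambda>x y. c * d x y) = 0"
proof -
  have "metric_amenable_length G T (\<lambda>x y. c * d x y) \<le> 0"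
  proof (rule ennreal_le_epsilon)
    fix e :: real assume "e > 0"
    then obtain Gs where Gs: "Gs \<in> amenable_chains G T" "chain_length G Gs d < e / c"
      using metric_amenable_length_zeroD[OF assms(2), of "e / c"] c by auto
    have "metric_amenable_length G T (\<lambda>x y. c * d x y) \<le> ennreal (chain_length G Gs (\<lambda>x y. c * d x y))"
      unfolding metric_amenable_length_def using Gs(1) by (rule INF_lower)
    also have "\<dots> \<le> ennreal e"
      using chain_length_scale_le[OF d c Gs(1)] Gs(2) c by (intro ennreal_leI) (simp add: field_simps)
    finally show "metric_amenable_length G T (\<lambda>x y. c * d x y) \<le> 0 + ennreal e" by simp
  qed
  then show ?thesis by simp
qed

text \<open>Put \<open>g = x \<otimes> inv y\<close>, so that \<open>x = g \<otimes> y\<close>.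
  Right invariance gives \<open>d (g \<otimes> z) z = d x y\<close> for all \<open>z\<close>; hence
  left translation by \<open>g\<close> displaces \<open>f\<close> by at most
  \<open>c * d x y\<close> everywhere, and averaging does not increase this bound.\<close>

lemma (in averaging_operator) lipschitz_average:
  assumes d: "d \<in> Delta G T" and f: "rucb G T f"
    and lip: "\<And>x y. x \<in> carrier G \<Longrightarrow> y \<in> carrier G \<Longrightarrow> \<bar>f x - f y\<bar> \<le> c * d x y"
    and x: "x \<in> carrier G" and y: "y \<in> carrier G"
  shows "\<bar>P f x - P f y\<bar> \<le> c * d x y"
proof -
  let ?g = "x \<otimes> inv y"
  have xy: "x = ?g \<otimes> y" using x y by (simp add: m_assoc)
  have g: "?g \<in> carrier G" using x y by simp
  have "\<bar>f (?g \<otimes> z) - f z\<bar> \<le> c * d x y" if z: "z \<in> carrier G" for z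
  proof -
    have "d (?g \<otimes> z) z = d ?g \<one>" using Delta_right_invariant[OF d g one_closed z] z by simp
    also have "\<dots> = d x y" using Delta_right_invariant[OF d g one_closed y] xy y by simp
    finally show ?thesis using lip[of "?g \<otimes> z" z] g z by simp
  qed
  then show ?thesis using displacement_le[OF f g y, of "c * d x y"] xy by simp
qed

text \<open>By induction on \<open>i\<close>, averages over the first members of the chain are
  composed and the variances add up. The induction covers all \<open>f\<close>, \<open>c\<close> and
  \<open>x\<close>, since the bound is needed at every point of a coset of the next
  subgroup.\<close>

lemma (in topological_group) chain_variance_le:
  assumes d: "d \<in> Delta G T" and Gs: "Gs \<in> amenable_chains G T"
  obtains Q where "averaging_operator G T (carrier G) Q"
    and "\<And>f c. \<lbrakk>rucb G T f; c > 0; \<And>x y. x \<in> carrier G \<Longrightarrow> y \<in> carrier G \<Longrightarrow> \<bar>f x - f y\<bar> \<le> c * d x y\<rbrakk>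
      \<Longrightarrow> Q (\<lambda>y. (f y)\<^sup>2) \<one> \<le> (Q f \<one>)\<^sup>2 + (c * chain_length G Gs d)\<^sup>2"
proof -
  define w where "w i = (SUP g\<in>carrier G. coset_diam G d (Gs ! Suc i) (Gs ! i) g)" for i
  have "\<exists>Q. averaging_operator G T (Gs ! i) Q \<and>
      (\<forall>f c. rucb G T f \<and> c > 0 \<and> (\<forall>x\<in>carrier G. \<forall>y\<in>carrier G. \<bar>f x - f y\<bar> \<le> c * d x y) \<longrightarrow>
        (\<forall>x\<in>carrier G. Q (\<lambda>y. (f y)\<^sup>2) x \<le> (Q f x)\<^sup>2 + c\<^sup>2 * (\<Sum>j<i. (w j)\<^sup>2)))"
    if "i < length Gs" for i
    using that
  proof (induction i)
    case 0
    show ?case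
      using averaging_operator_trivial amenable_chainsD(2)[OF Gs] by (intro exI[of _ "\<lambda>f. f"]) simp
  next
    case (Suc i)
    then have i: "i < length Gs" by simp
    from Suc.IH[OF i] obtain Q where Q: "averaging_operator G T (Gs ! i) Q"
      and var: "\<forall>f c. rucb G T f \<and> c > 0 \<and> (\<forall>x\<in>carrier G. \<forall>y\<in>carrier G. \<bar>f x - f y\<bar> \<le> c * d x y) \<longrightarrow>
        (\<forall>x\<in>carrier G. Q (\<lambda>y. (f y)\<^sup>2) x \<le> (Q f x)\<^sup>2 + c\<^sup>2 * (\<Sum>j<i. (w j)\<^sup>2))"
      by blast
    obtain P where P: "averaging_operator G T (Gs ! Suc i) P"
      using amenable_subgroup_averaging[OF amenable_chainsD(4)[OF Gs Suc.prems]] by blast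
    interpret Q: averaging_operator G T "Gs ! i" Q by fact
    interpret P: averaging_operator G T "Gs ! Suc i" P by fact
    note sub = subgroup.subset[OF P.K]
    have "P (Q (\<lambda>y. (f y)\<^sup>2)) x \<le> (P (Q f) x)\<^sup>2 + c\<^sup>2 * (\<Sum>j<Suc i. (w j)\<^sup>2)"
      if f: "rucb G T f" and c: "c > 0" and x: "x \<in> carrier G"
        and lip: "\<forall>x\<in>carrier G. \<forall>y\<in>carrier G. \<bar>f x - f y\<bar> \<le> c * d x y" for f c x
    proof -
      let ?S = "c\<^sup>2 * (\<Sum>j<i. (w j)\<^sup>2)"
      note Qf = Q.rucb_average[OF f]
      \<comment> \<open>The earlier variances enter as the constant \<open>?S\<close>, which
        \<open>P\<close> leaves unchanged.\<close>
      have "P (Q (\<lambda>y. (f y)\<^sup>2)) x \<le> P (\<lambda>y. 1 * (Q f y)\<^sup>2 + ?S) x"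
      proof (rule P.mono)
        show "rucb G T (Q (\<lambda>y. (f y)\<^sup>2))" by (intro Q.rucb_average rucb_power2 f)
        show "rucb G T (\<lambda>y. 1 * (Q f y)\<^sup>2 + ?S)" by (intro rucb_add_const rucb_power2 Qf)
        show "Q (\<lambda>y. (f y)\<^sup>2) (x \<otimes> k) \<le> 1 * (Q f (x \<otimes> k))\<^sup>2 + ?S" if "k \<in> Gs ! Suc i" for k
          using var f c lip x that sub by (simp add: subset_iff)
      qed (fact x)
      also have "\<dots> = P (\<lambda>y. (Q f y)\<^sup>2) x + ?S"
        using P.affine[OF rucb_power2[OF Qf] x, of 1] by simp
      \<comment> \<open>The new term is the variance of \<open>Q f\<close> on a coset of
        \<open>Gs ! Suc i\<close>. As \<open>Q f\<close> has Lipschitz constant \<open>c\<close> and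
        is right invariant under \<open>Gs ! i\<close>, its oscillation there is at most
        \<open>c * w i\<close>.\<close>
      also have "P (\<lambda>y. (Q f y)\<^sup>2) x \<le> (P (Q f) x)\<^sup>2 + (c * w i)\<^sup>2"
      proof (rule P.variance_le[OF Qf x])
        show "Q f (x \<otimes> h) \<le> Q f (x \<otimes> k) + c * w i" if "h \<in> Gs ! Suc i" "k \<in> Gs ! Suc i" for h k
          unfolding w_def using lip
          by (intro lipschitz_oscillation_le[OF d Q.K sub c _ _ x that] Q.lipschitz_average[OF d f]
            Q.invariant[OF f]) auto
      qed
      finally show ?thesis by (simp add: power_mult_distrib distrib_left)
    qed
    then show ?case
      using averaging_operator_compose[OF Q P amenable_chainsD(6)[OF Gs Suc.prems]]
      by (intro exI[of _ "\<lambda>f. P (Q f)"]) blast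
  qed
  \<comment> \<open>At the last index the chain has reached \<open>carrier G\<close>, so
    \<open>Q f\<close> is constant on \<open>G\<close>.\<close>
  from this[of "length Gs - 1"] obtain Q where Q: "averaging_operator G T (carrier G) Q"
    and var: "\<forall>f c. rucb G T f \<and> c > 0 \<and> (\<forall>x\<in>carrier G. \<forall>y\<in>carrier G. \<bar>f x - f y\<bar> \<le> c * d x y) \<longrightarrow>
        (\<forall>x\<in>carrier G. Q (\<lambda>y. (f y)\<^sup>2) x \<le> (Q f x)\<^sup>2 + c\<^sup>2 * (\<Sum>j<length Gs - 1. (w j)\<^sup>2))"
    using amenable_chainsD(1,3)[OF Gs] by auto
  have "(\<Sum>j<length Gs - 1. (w j)\<^sup>2) = (chain_length G Gs d)\<^sup>2"
    by (simp add: chain_length_def w_def sum_nonneg)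
  then show ?thesis
    using var by (intro that[OF Q]) (simp add: power_mult_distrib)
qed

section \<open>Approximate fixed points\<close>

text \<open>The \<open>d\<close>-ball about \<open>\<one>\<close> is open in \<open>T\<close>, and
  \<open>d (g \<otimes> x) x = d \<one> g\<close> makes the displacement by \<open>g\<close> small
  uniformly in \<open>x\<close>.\<close>

lemma (in topological_group) lipschitz_rucb:
  assumes d: "d \<in> Delta G T" and B: "\<And>x. x \<in> carrier G \<Longrightarrow> \<bar>f x\<bar> \<le> B" and "c > 0"
    and lip: "\<And>x y. x \<in> carrier G \<Longrightarrow> y \<in> carrier G \<Longrightarrow> \<bar>f x - f y\<bar> \<le> c * d x y"
  shows "rucb G T f"
proof (rule rucbI[OF B])
  fix \<epsilon> :: real assume "\<epsilon> > 0"
  define U where "U = {g \<in> carrier G. d \<one> g < \<epsilon> / c}"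
  have "openin (pseudometric_topology (carrier G) d) U"
    unfolding openin_pseudometric_topology
  proof (intro conjI ballI)
    fix x assume x: "x \<in> U"
    have "y \<in> U" if y: "y \<in> carrier G" "d x y < \<epsilon> / c - d \<one> x" for y
      using Delta_triangle[OF d one_closed _ y(1), of x] x y by (simp add: U_def)
    then show "\<exists>r>0. {y \<in> carrier G. d x y < r} \<subseteq> U"
      using x by (intro exI[of _ "\<epsilon> / c - d \<one> x"]) (auto simp: U_def)
  qed (simp add: U_def)
  then have "openin T U" using d by (simp add: Delta_def)
  moreover have "\<one> \<in> U"
    using \<open>\<epsilon> > 0\<close> \<open>c > 0\<close> Delta_refl[OF d one_closed one_closed] by (simp add: U_def)
  moreover have "\<bar>f (g \<otimes> x) - f x\<bar> \<le> \<epsilon>" if g: "g \<in> U" and x: "x \<in> carrier G" for g x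
  proof -
    have gG: "g \<in> carrier G" using g by (simp add: U_def)
    have "d (g \<otimes> x) x = d \<one> g"
      using Delta_right_invariant[OF d gG one_closed x] Delta_commute[OF d gG one_closed] x by simp
    then have "c * d (g \<otimes> x) x < \<epsilon>" using g \<open>c > 0\<close> by (simp add: U_def field_simps)
    then show ?thesis using lip[of "g \<otimes> x" x] gG x by simp
  qed
  ultimately show "\<exists>U. openin T U \<and> \<one> \<in> U \<and> (\<forall>g\<in>U. \<forall>x\<in>carrier G. \<bar>f (g \<otimes> x) - f x\<bar> \<le> \<epsilon>)"
    by (intro exI[of _ U]) simp
qed

text \<open>The approximant is the infimal convolution of \<open>f\<close> with a large multiple of \<open>d\<close>.\<close>

lemma (in topological_group) lipschitz_approximation:
  assumes d: "d \<in> Delta G T" and T: "pseudometric_topology (carrier G) d = T"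
    and f: "rucb G T f" and "\<epsilon> > 0"
  obtains h c where "rucb G T h" "c > 0"
    "\<And>x y. x \<in> carrier G \<Longrightarrow> y \<in> carrier G \<Longrightarrow> \<bar>h x - h y\<bar> \<le> c * d x y"
    "\<And>x. x \<in> carrier G \<Longrightarrow> \<bar>h x - f x\<bar> \<le> \<epsilon>"
proof -
  obtain B where "B > 0" and B: "\<And>x. x \<in> carrier G \<Longrightarrow> \<bar>f x\<bar> \<le> B"
    using rucb_bound[OF f] by metis
  obtain U where U: "openin T U" "\<one> \<in> U"
    "\<And>g x. g \<in> U \<Longrightarrow> x \<in> carrier G \<Longrightarrow> \<bar>f (g \<otimes> x) - f x\<bar> \<le> \<epsilon>"
    using rucb_unif[OF f \<open>\<epsilon> > 0\<close>] by metis
  \<comment> \<open>Here it matters that \<open>d\<close> generates \<open>T\<close>: the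
    neighbourhood \<open>U\<close> contains a \<open>d\<close>-ball.\<close>
  have "\<exists>r>0. {y \<in> carrier G. d \<one> y < r} \<subseteq> U"
    using U(1,2) unfolding T[symmetric] openin_pseudometric_topology by simp
  then obtain r where "r > 0" and r: "{y \<in> carrier G. d \<one> y < r} \<subseteq> U" by blast
  \<comment> \<open>With this constant the penalty \<open>c * d x y\<close> is at least
    \<open>2 * B\<close> outside the ball of radius \<open>r\<close>, which outweighs any variation
    of \<open>f\<close>.\<close>
  define c where "c = 2 * B / r"
  have "c > 0" using \<open>B > 0\<close> \<open>r > 0\<close> by (simp add: c_def)
  define h where "h x = (INF y\<in>carrier G. f y + c * d x y)" for x
  \<comment> \<open>This inequality gives both the lower estimate for \<open>h\<close> and the
    boundedness below of the set whose infimum defines \<open>h\<close>.\<close>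
  have unif: "f x - \<epsilon> \<le> f y + c * d x y" if x: "x \<in> carrier G" and y: "y \<in> carrier G" for x y
  proof (cases "d x y < r")
    case True
    have "d \<one> (x \<otimes> inv y) = d y x"
      using Delta_right_invariant[OF d one_closed _ y, of "x \<otimes> inv y"] x y by (simp add: m_assoc)
    then have "x \<otimes> inv y \<in> U" using True r x y Delta_commute[OF d x y] by auto
    then have "\<bar>f x - f y\<bar> \<le> \<epsilon>" using U(3)[of "x \<otimes> inv y" y] x y by (simp add: m_assoc)
    moreover have "0 \<le> c * d x y" using \<open>c > 0\<close> Delta_nonneg[OF d x y] by simp
    ultimately show ?thesis by linarith
  next
    case False
    then have "c * r \<le> c * d x y" using \<open>c > 0\<close> by simp
    moreover have "c * r = 2 * B" using \<open>r > 0\<close> by (simp add: c_def)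
    ultimately show ?thesis using B[OF x] B[OF y] \<open>\<epsilon> > 0\<close> by linarith
  qed
  have lower: "f x - \<epsilon> \<le> h x" if "x \<in> carrier G" for x
    unfolding h_def using unif[OF that] by (intro cINF_greatest) auto
  have upper: "h x \<le> f y + c * d x y" if "x \<in> carrier G" "y \<in> carrier G" for x y
    unfolding h_def using unif[OF that(1)] that by (intro cINF_lower bdd_belowI2[of _ "f x - \<epsilon>"]) auto
  have close: "\<bar>h x - f x\<bar> \<le> \<epsilon>" if "x \<in> carrier G" for x
    using lower[OF that] upper[OF that that] Delta_refl[OF d that that] \<open>\<epsilon> > 0\<close> by simp
  have half: "h x - c * d x y \<le> h y" if x: "x \<in> carrier G" and y: "y \<in> carrier G" for x y
    unfolding h_def[of y]
  proof (rule cINF_greatest)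
    fix z assume z: "z \<in> carrier G"
    have "c * d x z \<le> c * d x y + c * d y z"
      using \<open>c > 0\<close> Delta_triangle[OF d x y z] by (simp flip: distrib_left)
    then show "h x - c * d x y \<le> f z + c * d y z" using upper[OF x z] by linarith
  qed auto
  have lip: "\<bar>h x - h y\<bar> \<le> c * d x y" if "x \<in> carrier G" "y \<in> carrier G" for x y
    using half[OF that] half[OF that(2,1)] Delta_commute[OF d that] by (simp add: abs_le_iff)
  have "\<bar>h x\<bar> \<le> B + \<epsilon>" if "x \<in> carrier G" for x
    using close[OF that] B[OF that] by linarith
  then have "rucb G T h" using \<open>c > 0\<close> lip by (rule lipschitz_rucb[OF d])
  then show ?thesis using \<open>c > 0\<close> lip close by (rule that)
qed

section \<open>Points almost invariant for finitely many functions\<close>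

lemma (in averaging_operator) average_sum:
  assumes "finite J" "\<And>j. j \<in> J \<Longrightarrow> rucb G T (f j)" "x \<in> carrier G"
  shows "rucb G T (\<lambda>y. \<Sum>j\<in>J. f j y) \<and> P (\<lambda>y. \<Sum>j\<in>J. f j y) x = (\<Sum>j\<in>J. P (f j) x)"
  using assms(1,2)
proof (induction J rule: finite_induct)
  case empty
  then show ?case using affine[OF rucb_const assms(3), of 0 0 0] rucb_const by simp
next
  case (insert j J)
  then show ?case
    using rucb_lincomb[of G T "f j" "\<lambda>y. \<Sum>j\<in>J. f j y" 1 1]
      lincomb[of "f j" "\<lambda>y. \<Sum>j\<in>J. f j y" x 1 1] assms(3) by simp
qed

text \<open>
  Under the left-invariant mean \<open>f \<mapsto> Q f \<one>\<close>, both \<open>f j\<close> and its translate by \<open>g j\<close> are close in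
  mean square to the constant \<open>Q (f j) \<one>\<close>, hence to each other.
\<close>

lemma (in topological_group) lipschitz_almost_invariant_point:
  assumes d: "d \<in> Delta G T" and "metric_amenable_length G T d = 0"
    and J: "finite J" and "\<epsilon> > 0"
    and f: "\<And>j. j \<in> J \<Longrightarrow> rucb G T (f j)" and c: "\<And>j. j \<in> J \<Longrightarrow> c j > 0"
    and lip: "\<And>j x y. j \<in> J \<Longrightarrow> x \<in> carrier G \<Longrightarrow> y \<in> carrier G \<Longrightarrow> \<bar>f j x - f j y\<bar> \<le> c j * d x y"
    and g: "\<And>j. j \<in> J \<Longrightarrow> g j \<in> carrier G"
  obtains x where "x \<in> carrier G" "\<And>j. j \<in> J \<Longrightarrow> \<bar>f j (g j \<otimes> x) - f j x\<bar> < \<epsilon>"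
proof -
  \<comment> \<open>Adding \<open>1\<close> keeps \<open>C\<close> positive when \<open>J\<close> is
    empty; \<open>\<eta>\<close> is then chosen so that
    \<open>4 * \<eta>\<^sup>2 * C = \<epsilon>\<^sup>2\<close>.\<close>
  define C where "C = (\<Sum>j\<in>J. (c j)\<^sup>2) + 1"
  have "C > 0" by (simp add: C_def add_nonneg_pos sum_nonneg)
  define \<eta> where "\<eta> = \<epsilon> / (2 * sqrt C)"
  have "\<eta> > 0" using \<open>\<epsilon> > 0\<close> \<open>C > 0\<close> by (simp add: \<eta>_def)
  obtain Gs where Gs: "Gs \<in> amenable_chains G T" and len: "chain_length G Gs d < \<eta>"
    using metric_amenable_length_zeroD[OF assms(2) \<open>\<eta> > 0\<close>] by metis
  let ?l = "chain_length G Gs d"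
  obtain Q where Q: "averaging_operator G T (carrier G) Q"
    and var: "\<And>f c. \<lbrakk>rucb G T f; c > 0; \<And>x y. x \<in> carrier G \<Longrightarrow> y \<in> carrier G \<Longrightarrow> \<bar>f x - f y\<bar> \<le> c * d x y\<rbrakk>
      \<Longrightarrow> Q (\<lambda>y. (f y)\<^sup>2) \<one> \<le> (Q f \<one>)\<^sup>2 + (c * ?l)\<^sup>2"
    using chain_variance_le[OF d Gs] by metis
  interpret Q: averaging_operator G T "carrier G" Q by fact
  define m where "m j = Q (f j) \<one>" for j
  define q where "q j y = (f j y - m j)\<^sup>2" for j y
  have q_rucb: "rucb G T (q j)" if "j \<in> J" for j
    using rucb_power2[OF rucb_add_const[OF f[OF that], of 1 "- m j"]] by (simp add: q_def[abs_def])
  have Qq: "Q (q j) \<one> \<le> (c j * ?l)\<^sup>2" if j: "j \<in> J" for j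
  proof -
    have "q j = (\<lambda>y. 1 * (f j y)\<^sup>2 + (-2 * m j) * f j y + (m j)\<^sup>2)"
      by (simp add: q_def[abs_def] power2_diff algebra_simps)
    moreover have "Q (\<lambda>y. 1 * (1 * (f j y)\<^sup>2 + (-2 * m j) * f j y) + (m j)\<^sup>2) \<one>
        = 1 * (1 * Q (\<lambda>y. (f j y)\<^sup>2) \<one> + (-2 * m j) * Q (f j) \<one>) + (m j)\<^sup>2"
      using f[OF j] by (simp only: Q.affine Q.lincomb rucb_lincomb rucb_power2 one_closed)
    ultimately have "Q (q j) \<one> = Q (\<lambda>y. (f j y)\<^sup>2) \<one> - (m j)\<^sup>2"
      by (simp add: m_def power2_eq_square)
    then show ?thesis using var[OF f[OF j] c[OF j] lip[OF j]] by (simp add: m_def)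
  qed
  \<comment> \<open>Translation moves the evaluation point from \<open>\<one>\<close> to
    \<open>g j\<close>, and invariance under all of \<open>carrier G\<close> moves it back.\<close>
  have Qgq: "Q (\<lambda>y. q j (g j \<otimes> y)) \<one> = Q (q j) \<one>" if j: "j \<in> J" for j
    using Q.translate[OF q_rucb[OF j] g[OF j] one_closed]
      Q.invariant[OF q_rucb[OF j] one_closed g[OF j]] g[OF j] by simp
  let ?S = "\<lambda>y. \<Sum>j\<in>J. 2 * q j (g j \<otimes> y) + 2 * q j y"
  have term_rucb: "rucb G T (\<lambda>y. 2 * q j (g j \<otimes> y) + 2 * q j y)" if "j \<in> J" for j
    using that by (intro rucb_lincomb rucb_translate q_rucb g)
  have S: "rucb G T ?S" "Q ?S \<one> = (\<Sum>j\<in>J. Q (\<lambda>y. 2 * q j (g j \<otimes> y) + 2 * q j y) \<one>)"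
    using Q.average_sum[OF J term_rucb one_closed] by auto
  have "Q ?S \<one> \<le> (\<Sum>j\<in>J. 4 * (c j * ?l)\<^sup>2)"
    unfolding S(2)
  proof (rule sum_mono)
    fix j assume j: "j \<in> J"
    show "Q (\<lambda>y. 2 * q j (g j \<otimes> y) + 2 * q j y) \<one> \<le> 4 * (c j * ?l)\<^sup>2"
      using Q.lincomb[OF rucb_translate[OF q_rucb[OF j] g[OF j]] q_rucb[OF j] one_closed, of 2 2]
        Qgq[OF j] Qq[OF j] by simp
  qed
  also have "\<dots> = 4 * ?l\<^sup>2 * (\<Sum>j\<in>J. (c j)\<^sup>2)"
    by (simp add: power_mult_distrib sum_distrib_left mult_ac)
  also have "\<dots> \<le> 4 * ?l\<^sup>2 * C" by (intro mult_left_mono) (auto simp: C_def)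
  also have "\<dots> < 4 * \<eta>\<^sup>2 * C"
  proof -
    have "0 \<le> ?l" by (simp add: chain_length_def sum_nonneg)
    then have "?l\<^sup>2 < \<eta>\<^sup>2" using len by (intro power_strict_mono) auto
    then show ?thesis using \<open>C > 0\<close> by simp
  qed
  also have "\<dots> = \<epsilon>\<^sup>2" using \<open>C > 0\<close> by (simp add: \<eta>_def power_divide power_mult_distrib)
  finally have less: "Q ?S \<one> < \<epsilon>\<^sup>2" .
  \<comment> \<open>A mean below \<open>\<epsilon>\<^sup>2\<close> forces a value below
    \<open>\<epsilon>\<^sup>2\<close>. Summing over \<open>J\<close> beforehand lets one point serve
    every \<open>j\<close>, because all summands are nonnegative.\<close>
  have "\<exists>x\<in>carrier G. ?S x < \<epsilon>\<^sup>2"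
  proof (rule ccontr)
    assume "\<not> ?thesis"
    then have "\<epsilon>\<^sup>2 \<le> Q ?S \<one>" by (intro Q.ge_const[OF S(1) one_closed]) (simp add: not_less)
    then show False using less by simp
  qed
  then obtain x where x: "x \<in> carrier G" "?S x < \<epsilon>\<^sup>2" by blast
  have "\<bar>f j (g j \<otimes> x) - f j x\<bar> < \<epsilon>" if j: "j \<in> J" for j
  proof -
    \<comment> \<open>This is \<open>(u - v)\<^sup>2 \<le> 2 * u\<^sup>2 + 2 * v\<^sup>2\<close> for
      the deviations \<open>u\<close>, \<open>v\<close> of the two values from
      \<open>m j\<close>.\<close>
    have "(f j (g j \<otimes> x) - f j x)\<^sup>2 \<le> 2 * q j (g j \<otimes> x) + 2 * q j x"
      using zero_le_power2[of "f j (g j \<otimes> x) - m j + (f j x - m j)"]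
      by (simp add: q_def power2_eq_square algebra_simps)
    also have "\<dots> \<le> ?S x"
      using J j by (intro member_le_sum) (auto simp: q_def)
    also note x(2)
    finally show ?thesis
      using \<open>\<epsilon> > 0\<close> power2_less_imp_less[of "\<bar>f j (g j \<otimes> x) - f j x\<bar>" \<epsilon>] by simp
  qed
  then show ?thesis using x(1) by (intro that)
qed

text \<open>Uniform approximation by Lipschitz functions within \<open>\<epsilon> / 3\<close>
  reduces this to the Lipschitz case with tolerance \<open>\<epsilon> / 3\<close>.\<close>

lemma (in topological_group) almost_invariant_point:
  assumes d: "d \<in> Delta G T" and T: "pseudometric_topology (carrier G) d = T"
    and "metric_amenable_length G T d = 0" and J: "finite J" and "\<epsilon> > 0"
    and f: "\<And>j. j \<in> J \<Longrightarrow> rucb G T (f j)" and g: "\<And>j. j \<in> J \<Longrightarrow> g j \<in> carrier G"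
  obtains x where "x \<in> carrier G" "\<And>j. j \<in> J \<Longrightarrow> \<bar>f j (g j \<otimes> x) - f j x\<bar> < \<epsilon>"
proof -
  have "\<exists>h c. rucb G T h \<and> c > 0 \<and> (\<forall>x\<in>carrier G. \<forall>y\<in>carrier G. \<bar>h x - h y\<bar> \<le> c * d x y) \<and>
      (\<forall>x\<in>carrier G. \<bar>h x - f j x\<bar> \<le> \<epsilon> / 3)" if "j \<in> J" for j
    using lipschitz_approximation[OF d T f[OF that], of "\<epsilon> / 3"] \<open>\<epsilon> > 0\<close>
    by (metis divide_pos_pos zero_less_numeral)
  then obtain h c where hc: "\<And>j. j \<in> J \<Longrightarrow> rucb G T (h j) \<and> c j > 0 \<and>
      (\<forall>x\<in>carrier G. \<forall>y\<in>carrier G. \<bar>h j x - h j y\<bar> \<le> c j * d x y) \<and>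
      (\<forall>x\<in>carrier G. \<bar>h j x - f j x\<bar> \<le> \<epsilon> / 3)"
    by metis
  obtain x where x: "x \<in> carrier G" and hx: "\<And>j. j \<in> J \<Longrightarrow> \<bar>h j (g j \<otimes> x) - h j x\<bar> < \<epsilon> / 3"
    using lipschitz_almost_invariant_point[OF d assms(3) J, of "\<epsilon> / 3" h c g] hc g \<open>\<epsilon> > 0\<close> by auto
  have "\<bar>f j (g j \<otimes> x) - f j x\<bar> < \<epsilon>" if j: "j \<in> J" for j
  proof -
    have "\<bar>h j x - f j x\<bar> \<le> \<epsilon> / 3" "\<bar>h j (g j \<otimes> x) - f j (g j \<otimes> x)\<bar> \<le> \<epsilon> / 3"
      using hc[OF j] x g[OF j] by auto
    then show ?thesis using hx[OF j] by linarith
  qed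
  then show ?thesis using x by (intro that)
qed

section \<open>Fixed points\<close>

text \<open>By joint continuity the pairs \<open>(g, y)\<close> with \<open>f (\<phi> g y)\<close>
  close to \<open>f y\<close> form an open set containing
  \<open>{\<one>} \<times> topspace X\<close>. Compactness of \<open>X\<close> yields a tube
  \<open>U \<times> V\<close> inside it with \<open>topspace X \<subseteq> V\<close>, so one
  \<open>U\<close> works for all points \<open>y = \<phi> h x\<close> of the orbit.\<close>

lemma (in topological_group) orbit_function_rucb:
  assumes X: "compact_space X" and act: "group_action G (topspace X) \<phi>"
    and cont: "continuous_map (prod_topology T X) X (\<lambda>(g, x). \<phi> g x)"
    and f: "continuous_map X euclideanreal f" and x: "x \<in> topspace X"
  shows "rucb G T (\<lambda>g. f (\<phi> g x))"
proof -
  interpret group_action G "topspace X" \<phi> by fact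
  have "compact (f ` topspace X)"
    using image_compactin[OF _ f, of "topspace X"] X by (simp add: compact_space_def)
  then obtain B where B: "\<forall>y\<in>f ` topspace X. \<bar>y\<bar> \<le> B"
    using compact_imp_bounded bounded_real by metis
  show ?thesis
  proof (rule rucbI)
    show "\<bar>f (\<phi> g x)\<bar> \<le> B" if "g \<in> carrier G" for g
      using B element_image[OF that x] by simp
  next
    fix \<epsilon> :: real assume "\<epsilon> > 0"
    let ?W = "{p \<in> topspace (prod_topology T X). f (\<phi> (fst p) (snd p)) - f (snd p) \<in> {-\<epsilon><..<\<epsilon>}}"
    have "continuous_map (prod_topology T X) euclideanreal (\<lambda>p. f (\<phi> (fst p) (snd p)))"
      using continuous_map_compose[OF cont f] by (simp add: o_def case_prod_beta)
    moreover have "continuous_map (prod_topology T X) euclideanreal (\<lambda>p. f (snd p))"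
      using continuous_map_compose[OF continuous_map_snd f] by (simp add: o_def)
    ultimately have "openin (prod_topology T X) ?W"
      by (intro openin_continuous_map_preimage[where Y = euclideanreal] continuous_map_diff) auto
    moreover have "{\<one>} \<times> topspace X \<subseteq> ?W"
      using \<open>\<epsilon> > 0\<close> id_eq_one[symmetric] by (auto simp: topspace_eq)
    ultimately obtain U V where U: "openin T U" "\<one> \<in> U" "topspace X \<subseteq> V" "U \<times> V \<subseteq> ?W"
      using tube_lemma_right[of T X ?W "topspace X" \<one>] X by (auto simp: compact_space_def topspace_eq)
    have "\<bar>f (\<phi> (g \<otimes> h) x) - f (\<phi> h x)\<bar> \<le> \<epsilon>" if g: "g \<in> U" and h: "h \<in> carrier G" for g h
    proof -
      have "(g, \<phi> h x) \<in> ?W" using g U(3,4) element_image[OF h x] by blast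
      moreover have "\<phi> (g \<otimes> h) x = \<phi> g (\<phi> h x)"
        using g openin_subset_carrier[OF U(1)] h x by (intro composition_rule) auto
      ultimately show ?thesis by auto
    qed
    then show "\<exists>U. openin T U \<and> \<one> \<in> U \<and>
        (\<forall>g\<in>U. \<forall>h\<in>carrier G. \<bar>f (\<phi> (g \<otimes> h) x) - f (\<phi> h x)\<bar> \<le> \<epsilon>)"
      using U by (intro exI[of _ U]) simp
  qed
qed

text \<open>
  If no point were fixed, compactness would give finitely many pairs \<open>(f, g)\<close> of a continuous
  function and a group element, one of which moves each point by a definite amount.
\<close>

lemma (in topological_group) fixed_point:
  fixes X :: "'c topology"
  assumes d: "d \<in> Delta G T" and T: "pseudometric_topology (carrier G) d = T"
    and len: "metric_amenable_length G T d = 0"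
    and ne: "topspace X \<noteq> {}" and X: "compact_space X" "Hausdorff_space X"
    and act: "group_action G (topspace X) \<phi>"
    and cont: "continuous_map (prod_topology T X) X (\<lambda>(g, x). \<phi> g x)"
  shows "\<exists>x\<in>topspace X. \<forall>g\<in>carrier G. \<phi> g x = x"
proof (rule ccontr)
  assume no: "\<not> ?thesis"
  interpret group_action G "topspace X" \<phi> by fact
  have reg: "completely_regular_space X"
    using X by (simp add: compact_Hausdorff_or_regular_imp_normal_space normal_imp_completely_regular_space)
  have cont_act: "continuous_map X X (\<phi> g)" if "g \<in> carrier G" for g
  proof -
    have "continuous_map X (prod_topology T X) (\<lambda>x. (g, x))"
      using that by (simp add: continuous_map_pairwise o_def topspace_eq)
    from continuous_map_compose[OF this cont] show ?thesis by (simp add: o_def)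
  qed
  \<comment> \<open>These are the points at which moving by \<open>g\<close> raises \<open>f\<close>
    by more than \<open>1/2\<close>. The threshold lies below the jump from \<open>0\<close> to
    \<open>1\<close> of a function separating \<open>x\<close> from
    \<open>\<phi> g x\<close>.\<close>
  define W where "W p = {x \<in> topspace X. fst p (\<phi> (snd p) x) - fst p x \<in> {1/2<..}}"
    for p :: "('c \<Rightarrow> real) \<times> 'a"
  let ?A = "{(f, g). continuous_map X euclideanreal f \<and> g \<in> carrier G}"
  have "\<exists>p\<in>?A. x \<in> W p" if x: "x \<in> topspace X" for x
  proof -
    obtain g where g: "g \<in> carrier G" "\<phi> g x \<noteq> x" using no x by blast
    have gx: "\<phi> g x \<in> topspace X" using element_image[OF g(1) x] by simp
    then have "closedin X {\<phi> g x}" using X(2) by (simp add: closedin_Hausdorff_singleton)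
    then obtain f where "continuous_map X euclideanreal f" "f x = 0" "f ` {\<phi> g x} \<subseteq> {1}"
      using reg x g(2) unfolding completely_regular_space_alt by (metis DiffI singletonD)
    then show ?thesis using x g by (intro bexI[of _ "(f, g)"]) (auto simp: W_def)
  qed
  then have cover: "topspace X \<subseteq> \<Union>(W ` ?A)" by blast
  have opn: "openin X (W p)" if "p \<in> ?A" for p
  proof -
    obtain f g where p: "p = (f, g)" "continuous_map X euclideanreal f" "g \<in> carrier G"
      using \<open>p \<in> ?A\<close> by blast
    have "continuous_map X euclideanreal (\<lambda>x. f (\<phi> g x) - f x)"
      using continuous_map_compose[OF cont_act[OF p(3)] p(2)] p(2)
      by (intro continuous_map_diff) (simp_all add: o_def)
    then have "openin X {x \<in> topspace X. f (\<phi> g x) - f x \<in> {1/2<..}}"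
      by (rule openin_continuous_map_preimage) simp
    then show ?thesis by (simp add: W_def p(1))
  qed
  have "\<exists>\<F>. finite \<F> \<and> \<F> \<subseteq> W ` ?A \<and> topspace X \<subseteq> \<Union>\<F>"
  proof -
    have "\<forall>U\<in>W ` ?A. openin X U" "topspace X \<subseteq> \<Union>(W ` ?A)"
      using opn cover by blast+
    then show ?thesis using X(1)[unfolded compact_space_alt] by presburger
  qed
  then obtain \<F> where \<F>: "finite \<F>" "\<F> \<subseteq> W ` ?A" "topspace X \<subseteq> \<Union>\<F>"
    by blast
  obtain J where J: "J \<subseteq> ?A" "finite J" "\<F> = W ` J"
    using finite_subset_image[OF \<F>(1,2)] by blast
  obtain x where x: "x \<in> topspace X" using ne by blast
  have rg: "rucb G T (\<lambda>h. fst p (\<phi> h x))" "snd p \<in> carrier G" if "p \<in> J" for p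
    using orbit_function_rucb[OF X(1) act cont _ x] that J(1) by auto
  \<comment> \<open>The tolerance \<open>1/2\<close> matches the threshold in \<open>W\<close>, so
    the orbit point \<open>\<phi> h x\<close> lies in no \<open>W p\<close> with \<open>p\<close> in
    \<open>J\<close>, against the covering property.\<close>
  obtain h where h: "h \<in> carrier G"
    and small: "\<And>p. p \<in> J \<Longrightarrow> \<bar>fst p (\<phi> (snd p \<otimes> h) x) - fst p (\<phi> h x)\<bar> < 1/2"
    by (rule almost_invariant_point[where f = "\<lambda>p h. fst p (\<phi> h x)" and g = snd and \<epsilon> = "1/2",
          OF d T len J(2) _ rg that]) simp_all
  have "\<phi> h x \<in> topspace X" using element_image[OF h x] by simp
  then obtain f g where p: "(f, g) \<in> J" "f (\<phi> g (\<phi> h x)) - f (\<phi> h x) > 1/2"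
    using \<F>(3) J(3) by (auto simp: W_def)
  moreover have "\<phi> (g \<otimes> h) x = \<phi> g (\<phi> h x)"
    using composition_rule[OF x _ h] p(1) J(1) by blast
  ultimately show False using small[OF p(1)] by simp
qed

text \<open>If the \<open>d\<close>-ball of radius \<open>r\<close> about \<open>\<one>\<close> is
  contained in \<open>U\<close>, then the pair of \<open>carrier G\<close> and \<open>d\<close>
  divided by \<open>r\<close> belongs to \<open>TG G T U F\<close>, and rescaling keeps the length
  zero.\<close>

lemma (in topological_group) amenable_length_zero:
  assumes d: "d \<in> Delta G T" and T: "pseudometric_topology (carrier G) d = T"
    and len: "metric_amenable_length G T d = 0"
  shows "amenable_length G T = 0"
proof -
  have G: "G\<lparr>carrier := carrier G\<rparr> = G" "subtopology T (carrier G) = T"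
    by (simp_all flip: topspace_eq)
  obtain Gs where Gs: "Gs \<in> amenable_chains G T"
    using metric_amenable_length_zeroD[OF len zero_less_one] by metis
  \<comment> \<open>\<open>G\<close> is amenable as the last member of a chain, which exists since
    the length is finite.\<close>
  have am: "carrier G \<in> amenable_subgroups G T"
    using amenable_chainsD(4)[OF Gs, of "length Gs - 1"] amenable_chainsD(1,3)[OF Gs] by simp
  have "(INF (H, d)\<in>TG G T U F. metric_amenable_length (G\<lparr>carrier := H\<rparr>) (subtopology T H) d) \<le> 0"
    if U: "nbhd_of T \<one> U" and F: "F \<subseteq> carrier G" for U F
  proof -
    from U obtain V where V: "openin T V" "\<one> \<in> V" "V \<subseteq> U" by (auto simp: nbhd_of_def)
    have "\<exists>r>0. {y \<in> carrier G. d \<one> y < r} \<subseteq> V"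
      using V(1,2) unfolding T[symmetric] openin_pseudometric_topology by simp
    then obtain r where "r > 0" and r: "{y \<in> carrier G. d \<one> y < r} \<subseteq> V" by blast
    let ?d = "\<lambda>x y. (1 / r) * d x y"
    have "?d \<in> Delta G T" using Delta_scale[OF d, of "1 / r"] \<open>r > 0\<close> by simp
    \<comment> \<open>Each element of \<open>F\<close> is multiplied by \<open>\<one>\<close>, which
      lies in \<open>U\<close>.\<close>
    moreover have "F \<subseteq> U <#> carrier G"
      using F V(2,3) by (force simp: set_mult_def)
    moreover have "{x \<in> carrier G. ?d \<one> x < 1} \<subseteq> U"
      using r V(3) \<open>r > 0\<close> by (auto simp: field_simps)
    ultimately have "(carrier G, ?d) \<in> TG G T U F"
      using am by (simp add: TG_def G)
    from INF_lower[OF this, of "\<lambda>(H, d). metric_amenable_length (G\<lparr>carrier := H\<rparr>) (subtopology T H) d"]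
    show ?thesis
      using metric_amenable_length_scale_zero[OF d len, of "1 / r"] \<open>r > 0\<close> by (simp add: G)
  qed
  then have "amenable_length G T \<le> 0"
    unfolding amenable_length_def by (intro SUP_least) auto
  then show ?thesis by simp
qed

theorem corollary4p14:
  fixes G :: "('a, 'b) monoid_scheme" and T :: "'a topology" and d :: "'a \<Rightarrow> 'a \<Rightarrow> real"
  assumes "topological_group G T"
    and "d \<in> Delta G T"
    and "pseudometric_topology (carrier G) d = T"
    and "metric_amenable_length G T d = 0"
  shows "amenable_length G T = 0 \<and> extremely_amenable TYPE('x) G T"
proof -
  interpret topological_group G T by fact
  have "extremely_amenable TYPE('x) G T"
    unfolding extremely_amenable_def
    by (intro allI impI, elim conjE) (rule fixed_point[OF assms(2-4)])
  then show ?thesis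
    using amenable_length_zero[OF assms(2-4)] by simp
qed

end
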